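(* Let $m\ge 2$ and let $\tilde\mu$ be the probability $(\mu_1\times\mu_2)\circ F^{-1}$ on the two-sided $m$-Dyck shift $X$. Then $\tilde\mu$ is a $\mathcal T_2$-invariant probability.
   Context: Let $\Sigma=\{\alpha_1,\ldots,\alpha_m\}\cup\{\beta_1,\ldots,\beta_m\}$. The Dyck monoid $M$ is the monoid with zero $0$ and identity $1$ (the empty word), generated by $\alpha_i,\beta_i$ ($1\le i\le m$) with relations $\alpha_j\beta_j\equiv 1$ and $\alpha_i\beta_j\equiv 0$ for $i\ne j$. Let $L=\{l\in\Sigma^*: l\not\equiv 0 \text{ (mod } M)\}$ and $X=\{x\in\Sigma^{\mathbb Z}: x_r\cdots x_l\in L \text{ for all } r\le l\}$ (the two-sided $m$-Dyck shift). For $z\in\{0,1\}^{\mathbb Z}$ put $\tilde H_0(z)=0$, $\tilde H_i(z)=\sum_{j=0}^{i-1}(\delta_{1,z_j}-\delta_{0,z_j})$ for $i>0$ and $\tilde H_i(z)=\sum_{j=i}^{-1}(\delta_{0,z_j}-\delta_{1,z_j})$ for $i<0$. Let $S_{-\infty}^{-\infty}=\{z\in\{0,1\}^{\mathbb Z}: \liminf_{n\to+\infty}\tilde H_n(z)=-\infty,\ \liminf_{n\to-\infty}\tilde H_n(z)=-\infty\}$. Define $\gamma_k(z)=\sum_{i=0}^k z_i$ for $k\ge 0$, $\gamma_k(z)=-\sum_{i=k}^{-1}z_i$ for $k<0$, and $\varepsilon_n(z)=\max\{l<n: \tilde H_l(z)\le\tilde H_{n+1}(z)\}$. Define the Borel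 function $F:S_{-\infty}^{-\infty}\times\{1,\ldots,m\}^{\mathbb Z}\to\Sigma^{\mathbb Z}$ by: $F(z,a)_n=\alpha_j$ if $z_n=1$ and $a_{\gamma_n(z)}=j$; $F(z,a)_n=\beta_j$ if $z_n=0$ and $a_{\gamma_k(z)}=j$ where $k=\varepsilon_n(z)$. $F$ takes values in $X$. Let $\mu_1$ and $\mu_2$ be the symmetric (uniform i.i.d.) product measures on $\{0,1\}^{\mathbb Z}$ and $\{1,\ldots,m\}^{\mathbb Z}$; then $\mu_1(S_{-\infty}^{-\infty})=1$, and $\tilde\mu=(\mu_1\times\mu_2)\circ F^{-1}$ is a Borel probability on $X$. The double-tail relation is $\mathcal T_2(X)=\{(x,x')\in X\times X: \exists n\ge 0\ \forall |k|>n,\ x_k=x'_k\}$. A $\mathcal T_2(X)$-holonomy is an injective Borel function $g:A\to g(A)$ with $A\subset X$ Borel and $(x,g(x))\in\mathcal T_2(X)$ for all $x\in A$. A Borel probability $\mu$ on $X$ is $\mathcal T_2$-invariant if $\mu(A)=\mu(g(A))$ for every $\mathcal T_2(X)$-holonomy $g:A\to g(A)$. *)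

theory Defs
  imports "HOL-Probability.Probability"
begin

section \<open>The Dyck monoid and the Dyck shift\<close>

datatype letter = Alpha nat | Beta nat

definition dyck_alphabet :: "nat \<Rightarrow> letter set" where
  "dyck_alphabet m = Alpha ` {1..m} \<union> Beta ` {1..m}"

text \<open>
  The free monoid with zero: \<open>None\<close> is the zero \<open>0\<close>, \<open>Some []\<close> is the identity \<open>1\<close>.
\<close>

fun word_mult :: "letter list option \<Rightarrow> letter list option \<Rightarrow> letter list option" where
  "word_mult (Some u) (Some v) = Some (u @ v)"
| "word_mult _ _ = None"

text \<open>
  The congruence on the free monoid with zero over \<open>dyck_alphabet m\<close> generated by the
  defining relations; the Dyck monoid is the quotient by it.
\<close>

inductive dyck_eq :: "nat \<Rightarrow> letter list option \<Rightarrow> letter list option \<Rightarrow> bool" for m where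
  match: "j \<in> {1..m} \<Longrightarrow> dyck_eq m (Some [Alpha j, Beta j]) (Some [])"
| mismatch: "i \<in> {1..m} \<Longrightarrow> j \<in> {1..m} \<Longrightarrow> i \<noteq> j \<Longrightarrow> dyck_eq m (Some [Alpha i, Beta j]) None"
| zero: "dyck_eq m None None"
| refl: "w \<in> lists (dyck_alphabet m) \<Longrightarrow> dyck_eq m (Some w) (Some w)"
| sym: "dyck_eq m u v \<Longrightarrow> dyck_eq m v u"
| trans: "dyck_eq m u v \<Longrightarrow> dyck_eq m v w \<Longrightarrow> dyck_eq m u w"
| mult: "dyck_eq m u u' \<Longrightarrow> dyck_eq m v v' \<Longrightarrow> dyck_eq m (word_mult u v) (word_mult u' v')"

definition dyck_language :: "nat \<Rightarrow> letter list set" where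
  "dyck_language m = {w \<in> lists (dyck_alphabet m). \<not> dyck_eq m (Some w) None}"

definition dyck_shift :: "nat \<Rightarrow> (int \<Rightarrow> letter) set" where
  "dyck_shift m = {x \<in> UNIV \<rightarrow> dyck_alphabet m. \<forall>r l. r \<le> l \<longrightarrow> map x [r..l] \<in> dyck_language m}"

text \<open>
  The alphabet is finite and discrete and the index set countable, so the product
  sigma-algebra below is the Borel sigma-algebra of the product topology.
\<close>

definition dyck_borel :: "nat \<Rightarrow> (int \<Rightarrow> letter) measure" where
  "dyck_borel m =
     restrict_space (Pi\<^sub>M UNIV (\<lambda>_. count_space (dyck_alphabet m))) (dyck_shift m)"

section \<open>The coding map\<close>

definition height :: "(int \<Rightarrow> nat) \<Rightarrow> int \<Rightarrow> int" where
  "height z i =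
     (if i > 0 then \<Sum>j=0..i-1. of_bool (z j = 1) - of_bool (z j = 0)
      else if i < 0 then \<Sum>j=i..-1. of_bool (z j = 0) - of_bool (z j = 1)
      else 0)"

definition S_minus_minus :: "(int \<Rightarrow> nat) set" where
  "S_minus_minus = {z \<in> UNIV \<rightarrow> {0, 1}.
     Liminf at_top (\<lambda>n. ereal (of_int (height z n))) = - \<infinity> \<and>
     Liminf at_bot (\<lambda>n. ereal (of_int (height z n))) = - \<infinity>}"

definition gamma_index :: "int \<Rightarrow> (int \<Rightarrow> nat) \<Rightarrow> int" where
  "gamma_index k z =
     (if k \<ge> 0 then \<Sum>i=0..k. int (z i) else - (\<Sum>i=k..-1. int (z i)))"

text \<open>
  On \<open>S_minus_minus\<close> the set of admissible \<open>l\<close> is infinite but bounded above and nonempty;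
  \<open>Max\<close> would be unspecified on it, \<open>GREATEST\<close> is its maximum.
\<close>

definition epsilon_index :: "int \<Rightarrow> (int \<Rightarrow> nat) \<Rightarrow> int" where
  "epsilon_index n z = (GREATEST l. l < n \<and> height z l \<le> height z (n + 1))"

definition coding :: "(int \<Rightarrow> nat) \<times> (int \<Rightarrow> nat) \<Rightarrow> int \<Rightarrow> letter" where
  "coding = (\<lambda>(z, a) n.
     if z n = 1 then Alpha (a (gamma_index n z))
     else Beta (a (gamma_index (epsilon_index n z) z)))"

definition mu1 :: "(int \<Rightarrow> nat) measure" where
  "mu1 = Pi\<^sub>M UNIV (\<lambda>_. uniform_count_measure {0, 1})"

definition mu2 :: "nat \<Rightarrow> (int \<Rightarrow> nat) measure" where
  "mu2 m = Pi\<^sub>M UNIV (\<lambda>_. uniform_count_measure {1..m})"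

text \<open>
  The product measure is restricted to the domain of the coding map, outside of which the
  values of \<open>coding\<close> are meaningless; this domain has full measure.
\<close>

definition mu_tilde :: "nat \<Rightarrow> (int \<Rightarrow> letter) measure" where
  "mu_tilde m =
     distr (restrict_space (mu1 \<Otimes>\<^sub>M mu2 m) (S_minus_minus \<times> space (mu2 m)))
       (dyck_borel m) coding"

section \<open>Invariance under the double-tail relation\<close>

definition double_tail :: "nat \<Rightarrow> ((int \<Rightarrow> letter) \<times> (int \<Rightarrow> letter)) set" where
  "double_tail m = {(x, x') \<in> dyck_shift m \<times> dyck_shift m.
     \<exists>n\<ge>0. \<forall>k. \<bar>k\<bar> > n \<longrightarrow> x k = x' k}"

text \<open>A holonomy is a function on \<open>A\<close>; the values of \<open>g\<close> outside \<open>A\<close> are irrelevant.\<close>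

definition holonomy ::
    "nat \<Rightarrow> (int \<Rightarrow> letter) set \<Rightarrow> ((int \<Rightarrow> letter) \<Rightarrow> int \<Rightarrow> letter) \<Rightarrow> bool" where
  "holonomy m A g \<longleftrightarrow>
     A \<in> sets (dyck_borel m) \<and> inj_on g A \<and>
     g \<in> restrict_space (dyck_borel m) A \<rightarrow>\<^sub>M dyck_borel m \<and>
     (\<forall>x\<in>A. (x, g x) \<in> double_tail m)"

definition borel_probability :: "nat \<Rightarrow> (int \<Rightarrow> letter) measure \<Rightarrow> bool" where
  "borel_probability m M \<longleftrightarrow> sets M = sets (dyck_borel m) \<and> prob_space M"

definition double_tail_invariant :: "nat \<Rightarrow> (int \<Rightarrow> letter) measure \<Rightarrow> bool" where
  "double_tail_invariant m M \<longleftrightarrow>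
     (\<forall>A g. holonomy m A g \<longrightarrow> emeasure M A = emeasure M (g ` A))"

end

theory Submission
  imports Defs
begin

text \<open>
  The labels are read by the coding map along an injection, so the law does not change if they are
  attached to the positions of the ones of \<open>z\<close> instead; a point of the Dyck shift with recurrent
  skeleton is then determined by its skeleton and the labels of its \<open>Alpha\<close>s, since each \<open>Beta\<close> has
  the label of the \<open>Alpha\<close> it is matched with. A holonomy is countably many replacements of a finite
  block \<open>u\<close> by a block \<open>v\<close>. If \<open>u\<close> and \<open>v\<close> have equally many \<open>Alpha\<close>s, then the replacement comes
  from permuting and relabelling finitely many independent uniform coordinates. If not, then the
  replacement shifts the matching of the far right half with the far left half, and both points can
  be in the Dyck shift only if the open \<open>Alpha\<close>s of the left half carry an eventually periodic
  sequence of labels, which has probability zero for \<open>m \<ge> 2\<close>.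
\<close>

section \<open>Heights and last visits\<close>

text \<open>Labels are moved to positions because \<open>gamma_index\<close> counts ones from the
  origin: a change inside a block can move the indices of all ones outside it, even when the block
  keeps its number of ones. Labels at positions confine the change to finitely many coordinates.
  Recurrence is used on both sides. Unboundedness below on the left gives every \<open>Beta\<close>
  a partner; on the right it gives every low level a first passage beyond the block, so that labels
  far on the left are tested by letters far on the right. Membership in the shift is used in both
  directions, by different means. That a coded word is nonzero needs an invariant of the congruence,
  the partial action on stacks; that a word with two matched letters of distinct labels is zero
  needs a derivation in the congruence.\<close>

lemma height_step:
  "height z (i + 1) = height z i + of_bool (z i = 1) - of_bool (z i = 0)"
proof -
  consider "i > 0" | "i = 0" | "i = -1" | "i < -1" by linarith
  then show ?thesis
  proof cases
    case 1
    then have "{0..i} = insert i {0..i - 1}" by auto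
    with 1 show ?thesis by (simp add: height_def)
  next
    case 4
    then have "{i..-1} = insert i {i + 1..-1}" by auto
    with 4 show ?thesis by (simp add: height_def)
  qed (auto simp: height_def)
qed

lemma height_0 [simp]: "height z 0 = 0"
  by (simp add: height_def)

lemma height_up: "z i = 1 \<Longrightarrow> height z (i + 1) = height z i + 1"
  and height_down: "z i = 0 \<Longrightarrow> height z (i + 1) = height z i - 1"
  by (simp_all add: height_step)

lemma height_diff_le:
  assumes "i \<le> j" shows "\<bar>height z j - height z i\<bar> \<le> j - i"
  using assms
proof (induction j rule: int_ge_induct)
  case (step j)
  then show ?case using height_step[of z j] by (auto simp: of_bool_def split: if_splits)
qed simp

lemma height_abs_le: "\<bar>height z i\<bar> \<le> \<bar>i\<bar>"
  using height_diff_le[of 0 i z] height_diff_le[of i 0 z] by (cases "i \<ge> 0") auto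

lemma height_shift_right:
  assumes "\<And>i. i \<ge> N \<Longrightarrow> z i = z' i" "k \<ge> N"
  shows "height z' k = height z k + (height z' N - height z N)"
  using assms(2)
proof (induction k rule: int_ge_induct)
  case (step i)
  then show ?case using height_step[of z i] height_step[of z' i] assms(1)[of i] by simp
qed simp

lemma height_shift_left:
  assumes "\<And>i. i < N \<Longrightarrow> z i = z' i" "k \<le> N"
  shows "height z' k = height z k + (height z' N - height z N)"
  using assms(2)
proof (induction k rule: int_le_induct)
  case (step i)
  then show ?case
    using height_step[of z "i - 1"] height_step[of z' "i - 1"] assms(1)[of "i - 1"] by simp
qed simp

text \<open>Turns a difference of height increments over a common window into a difference of
  numbers of ones, since the length of the window cancels.\<close>

lemma height_eq_sum:
  assumes "z \<in> UNIV \<rightarrow> {0, 1}" "i \<le> j"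
  shows "height z j = height z i + 2 * (\<Sum>k\<in>{i..<j}. int (z k)) - (j - i)"
  using assms(2)
proof (induction j rule: int_ge_induct)
  case (step j)
  have "{i..<j + 1} = insert j {i..<j}" using step by auto
  moreover have "z j = 0 \<or> z j = 1" using assms(1) by auto
  ultimately show ?case using step height_step[of z j] by auto
qed simp

definition recurrent :: "(int \<Rightarrow> nat) \<Rightarrow> bool" where
  "recurrent z \<longleftrightarrow> z \<in> UNIV \<rightarrow> {0, 1} \<and>
     (\<forall>K N. \<exists>n\<ge>N. height z n \<le> K) \<and> (\<forall>K N. \<exists>n\<le>N. height z n \<le> K)"

lemma recurrent_binary: "recurrent z \<Longrightarrow> z i = 0 \<or> z i = 1"
  by (auto simp: recurrent_def)

lemma Liminf_int_minus_infinity_iff: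
  fixes f :: "'a \<Rightarrow> int"
  shows "Liminf F (\<lambda>n. ereal (of_int (f n))) = -\<infinity> \<longleftrightarrow> (\<forall>K. \<exists>\<^sub>F n in F. f n \<le> K)"
proof
  assume L: "Liminf F (\<lambda>n. ereal (of_int (f n))) = -\<infinity>"
  show "\<forall>K. \<exists>\<^sub>F n in F. f n \<le> K"
  proof (rule ccontr)
    assume "\<not> ?thesis"
    then obtain K where "\<forall>\<^sub>F n in F. K < f n" by (auto simp: not_frequently not_le)
    then have "\<forall>\<^sub>F n in F. ereal (of_int K) \<le> ereal (of_int (f n))"
      by eventually_elim simp
    then have "ereal (of_int K) \<le> Liminf F (\<lambda>n. ereal (of_int (f n)))"
      by (rule Liminf_bounded)
    with L show False by simp
  qed
next
  assume R: "\<forall>K. \<exists>\<^sub>F n in F. f n \<le> K"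
  show "Liminf F (\<lambda>n. ereal (of_int (f n))) = -\<infinity>"
  proof (rule ccontr)
    assume "\<not> ?thesis"
    then obtain y where y: "y < Liminf F (\<lambda>n. ereal (of_int (f n)))" "y > -\<infinity>"
      using dense[of "-\<infinity>"] by (metis ereal_infty_less(2))
    then have ev: "\<forall>\<^sub>F n in F. y < ereal (of_int (f n))" using less_LiminfD by blast
    from y obtain r where "y \<ge> ereal r" by (cases y) (auto intro: that[of 0])
    with ev have "\<forall>\<^sub>F n in F. ereal r < ereal (of_int (f n))"
      by (auto elim!: eventually_mono dest: order.strict_trans1 simp del: less_ereal.simps)
    then have "\<forall>\<^sub>F n in F. \<not> f n \<le> \<lfloor>r\<rfloor>"
      by (rule eventually_mono) (simp, linarith)
    with R show False by (auto simp: frequently_def)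
  qed
qed

lemma S_minus_minus_eq: "S_minus_minus = Collect recurrent"
  unfolding S_minus_minus_def recurrent_def Liminf_int_minus_infinity_iff
    frequently_def eventually_at_top_linorder eventually_at_bot_linorder
  by (auto; metis)

text \<open>Frees the level in \<open>epsilon_index\<close> from the position: a stack is described
  by all levels below the current height at once, and matchings of two paths are compared at shifted
  levels.\<close>

definition last_visit :: "(int \<Rightarrow> nat) \<Rightarrow> int \<Rightarrow> int \<Rightarrow> int" where
  "last_visit z n t = (GREATEST l. l < n \<and> height z l \<le> t)"

lemma epsilon_index_eq: "epsilon_index n z = last_visit z n (height z (n + 1))"
  by (simp add: epsilon_index_def last_visit_def)

lemma last_visit_cong:
  assumes "\<And>l. l < n \<and> height z l \<le> t \<longleftrightarrow> l < n' \<and> height z' l \<le> t'"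
  shows "last_visit z n t = last_visit z' n' t'"
  unfolding last_visit_def by (simp only: assms)

lemma last_visit_extend:
  assumes "n \<le> k" "\<And>i. n \<le> i \<Longrightarrow> i < k \<Longrightarrow> t < height z i"
  shows "last_visit z k t = last_visit z n t"
  by (rule last_visit_cong) (use assms in \<open>force simp: not_le[symmetric]\<close>)

lemma last_visit_eqI:
  assumes "l < n" "height z l \<le> t" "\<And>k. l < k \<Longrightarrow> k < n \<Longrightarrow> t < height z k"
  shows "last_visit z n t = l"
  unfolding last_visit_def
  by (rule Greatest_equality) (use assms in \<open>force simp: not_le[symmetric]\<close>)+

lemma last_visit:
  assumes z: "recurrent z" and t: "t < height z n"
  defines "l \<equiv> last_visit z n t"
  shows "l < n" "height z l = t" "z l = 1" "\<And>k. l < k \<Longrightarrow> k \<le> n \<Longrightarrow> t < height z k"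
proof -
  \<comment> \<open>Positions to the left of \<open>n\<close> are written \<open>n - 1 - i\<close>
    with \<open>i\<close> natural, so that \<open>LEAST\<close> yields the rightmost one at or below
    \<open>t\<close>.\<close>
  define P where "P i \<longleftrightarrow> height z (n - 1 - int i) \<le> t" for i
  obtain l0 where l0: "l0 \<le> n - 1" "height z l0 \<le> t" using z unfolding recurrent_def by blast
  then have "P (nat (n - 1 - l0))" by (simp add: P_def)
  then have Pi: "P (LEAST i. P i)" and less: "\<And>i. i < (LEAST i. P i) \<Longrightarrow> \<not> P i"
    by (auto intro: LeastI dest: not_less_Least)
  define l' where "l' = n - 1 - int (LEAST i. P i)"
  have l': "l' < n" "height z l' \<le> t" using Pi by (auto simp: l'_def P_def)
  have above: "t < height z k" if "l' < k" "k < n" for k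
  proof -
    have "nat (n - 1 - k) < (LEAST i. P i)" using that unfolding l'_def by linarith
    from less[OF this] that show ?thesis by (simp add: P_def)
  qed
  have "l = l'" unfolding l_def using l' above by (rule last_visit_eqI)
  then show "l < n" and ab: "\<And>k. l < k \<Longrightarrow> k \<le> n \<Longrightarrow> t < height z k"
    using l' above t by (auto simp: order.order_iff_strict)
  \<comment> \<open>Already one step after \<open>l\<close> the path is above \<open>t\<close>; as
    steps have size one, it sits exactly at \<open>t\<close> at \<open>l\<close> and moves
    up.\<close>
  then have "t < height z (l + 1)" by auto
  with \<open>l = l'\<close> l' height_step[of z l] show "height z l = t" "z l = 1"
    by (auto simp: of_bool_def split: if_splits)
qed

definition code :: "(int \<Rightarrow> nat) \<times> (int \<Rightarrow> nat) \<Rightarrow> int \<Rightarrow> letter" where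
  "code = (\<lambda>(z, b) n. if z n = 1 then Alpha (b n) else Beta (b (epsilon_index n z)))"

lemma coding_eq_code: "coding (z, a) = code (z, \<lambda>l. a (gamma_index l z))"
  by (simp add: coding_def code_def)

lemma epsilon_index:
  assumes "recurrent z" "z n = 0"
  defines "l \<equiv> epsilon_index n z"
  shows "l < n" "height z l = height z (n + 1)" "z l = 1"
    "\<And>k. l < k \<Longrightarrow> k \<le> n \<Longrightarrow> height z (n + 1) < height z k"
  using last_visit[of z "height z (n + 1)" n] assms(1) height_down[of z n, OF assms(2)]
  unfolding l_def epsilon_index_eq by auto

section \<open>Words of the Dyck monoid\<close>

text \<open>The Dyck monoid acts by partial maps on infinite stacks, so a word that succeeds on some
  stack is nonzero.\<close>

fun act :: "letter \<Rightarrow> (nat \<Rightarrow> nat) \<Rightarrow> (nat \<Rightarrow> nat) option" where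
  "act (Alpha j) s = Some (case_nat j s)"
| "act (Beta j) s = (if s 0 = j then Some (\<lambda>i. s (Suc i)) else None)"

fun run :: "letter list \<Rightarrow> (nat \<Rightarrow> nat) \<Rightarrow> (nat \<Rightarrow> nat) option" where
  "run [] s = Some s"
| "run (c # w) s = Option.bind (act c s) (run w)"

fun run_option :: "letter list option \<Rightarrow> (nat \<Rightarrow> nat) \<Rightarrow> (nat \<Rightarrow> nat) option" where
  "run_option (Some w) = run w"
| "run_option None = (\<lambda>_. None)"

lemma run_append: "run (u @ v) s = Option.bind (run u s) (run v)"
  by (induction u arbitrary: s) (auto simp: Option.bind_assoc cong: bind_option_cong)

lemma run_option_mult: "run_option (word_mult u v) s = Option.bind (run_option u s) (run_option v)"
  by (cases u; cases v) (auto simp: run_append bind_eq_None_conv)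

text \<open>Composition of partial maps respects \<open>word_mult\<close>, and the relations hold
  for the maps: a push followed by a pop is the identity if the labels agree and fails everywhere
  otherwise.\<close>

lemma dyck_eq_run_option: "dyck_eq m u v \<Longrightarrow> run_option u = run_option v"
proof (induction rule: dyck_eq.induct)
  case (mult u u' v v')
  show ?case by (rule ext) (simp only: mult.IH run_option_mult)
qed (auto simp: fun_eq_iff)

text \<open>The stack at time \<open>r\<close> consists of the labels at the last visits to the levels below the
  current height, nearest level on top.\<close>

lemma run_code:
  assumes z: "z \<in> UNIV \<rightarrow> {0, 1}" and "r \<le> l + 1"
  shows "run (map (code (z, b)) [r..l])
      (\<lambda>i. b (last_visit z r (height z r - 1 - int i)))
    = Some (\<lambda>i. b (last_visit z (l + 1) (height z (l + 1) - 1 - int i)))"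
proof -
  have "r - 1 \<le> l" using assms(2) by simp
  then show ?thesis
  proof (induction l rule: int_ge_induct)
    case (step l)
    define k where "k = l + 1"
    have "act (code (z, b) k) (\<lambda>i. b (last_visit z k (height z k - 1 - int i)))
      = Some (\<lambda>i. b (last_visit z (k + 1) (height z (k + 1) - 1 - int i)))"
    proof (cases "z k = 1")
      case True
      then have H: "height z (k + 1) = height z k + 1" by (rule height_up)
      \<comment> \<open>After a push the new top belongs to the level just left, last visited at
        \<open>k\<close>; deeper levels lie below \<open>height z k\<close>, so \<open>k\<close> is
        no visit to them.\<close>
      have "case_nat (b k) (\<lambda>i. b (last_visit z k (height z k - 1 - int i))) i
          = b (last_visit z (k + 1) (height z (k + 1) - 1 - int i))" for i
      proof (cases i)
        case 0
        have "last_visit z (k + 1) (height z k) = k" by (rule last_visit_eqI) auto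
        then show ?thesis by (simp add: 0 H)
      next
        case (Suc j)
        have "height z (k + 1) - 1 - int i = height z k - 1 - int j" by (simp add: Suc H)
        moreover have "last_visit z (k + 1) (height z k - 1 - int j)
            = last_visit z k (height z k - 1 - int j)"
          by (rule last_visit_extend) auto
        ultimately show ?thesis by (simp only: Suc nat.case)
      qed
      then show ?thesis using True by (simp add: code_def fun_eq_iff)
    next
      case False
      then have zk: "z k = 0" using z by auto
      then have H: "height z (k + 1) = height z k - 1" by (rule height_down)
      have "last_visit z (k + 1) (height z (k + 1) - 1 - int i)
          = last_visit z k (height z k - 1 - int (Suc i))" for i
      proof -
        have "last_visit z (k + 1) (height z k - 1 - int (Suc i))
            = last_visit z k (height z k - 1 - int (Suc i))"
        proof (rule last_visit_extend)
          fix j assume "k \<le> j" "j < k + 1"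
          then have "j = k" by simp
          then show "height z k - 1 - int (Suc i) < height z j" by simp
        qed simp
        moreover have "height z (k + 1) - 1 - int i = height z k - 1 - int (Suc i)"
          by (simp add: H)
        ultimately show ?thesis by (simp only:)
      qed
      \<comment> \<open>The top of the stack sits at level \<open>height z k - 1\<close>, the one
        that \<open>epsilon_index\<close> searches, so the \<open>Beta\<close> pops exactly the
        label it carries.\<close>
      then show ?thesis using False by (simp add: code_def epsilon_index_eq H)
    qed
    moreover have "[r..l + 1] = [r..l] @ [k]"
      using step.hyps upto_rec2[of r "l + 1"] by (simp add: k_def)
    ultimately show ?case using step.IH by (simp add: run_append k_def)
  qed simp
qed

lemma code_in_dyck_shift:
  assumes z: "z \<in> UNIV \<rightarrow> {0, 1}" and b: "b \<in> UNIV \<rightarrow> {1..m}"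
  shows "code (z, b) \<in> dyck_shift m"
proof -
  have alph: "code (z, b) n \<in> dyck_alphabet m" for n
    using b by (auto simp: code_def dyck_alphabet_def Pi_iff)
  have "\<not> dyck_eq m (Some (map (code (z, b)) [r..l])) None" if "r \<le> l" for r l
    using run_code[OF z, of r l b] that
    by (auto dest!: dyck_eq_run_option fun_cong[where x = "\<lambda>i. b (last_visit z r (height z r - 1 - int i))"])
  with alph show ?thesis by (auto simp: dyck_shift_def dyck_language_def)
qed

section \<open>Decoding: matched letters and recovery from skeleton and labels\<close>

definition skeleton :: "(int \<Rightarrow> letter) \<Rightarrow> int \<Rightarrow> nat" where
  "skeleton x i = (case x i of Alpha _ \<Rightarrow> 1 | Beta _ \<Rightarrow> 0)"

definition label :: "(int \<Rightarrow> letter) \<Rightarrow> int \<Rightarrow> nat" where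
  "label x i = (case x i of Alpha j \<Rightarrow> j | Beta j \<Rightarrow> j)"

lemma skeleton_binary: "skeleton x \<in> UNIV \<rightarrow> {0, 1}"
  by (auto simp: skeleton_def split: letter.splits)

lemma letter_eq: "x i = (if skeleton x i = 1 then Alpha (label x i) else Beta (label x i))"
  by (simp add: skeleton_def label_def split: letter.splits)

lemma skeleton_code: "z \<in> UNIV \<rightarrow> {0, 1} \<Longrightarrow> skeleton (code (z, b)) = z"
  by (fastforce simp: skeleton_def code_def fun_eq_iff)

lemma label_range: "x i \<in> dyck_alphabet m \<Longrightarrow> label x i \<in> {1..m}"
  by (auto simp: label_def dyck_alphabet_def)

text \<open>Read letter by letter, the word reduces to a pushdown \<open>q\<close>. As the path
  never goes below its start, \<open>q\<close> is nonempty whenever a \<open>Beta\<close> arrives,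
  and the last letter of \<open>q\<close> either cancels it or makes the word zero.\<close>

lemma excursion_word:
  assumes x: "x \<in> UNIV \<rightarrow> dyck_alphabet m" and "r - 1 \<le> l"
    and "\<And>k. r \<le> k \<Longrightarrow> k \<le> l + 1 \<Longrightarrow> height (skeleton x) r \<le> height (skeleton x) k"
  shows "dyck_eq m (Some (map x [r..l])) None \<or>
    (\<exists>q\<in>lists {1..m}. int (length q) = height (skeleton x) (l + 1) - height (skeleton x) r \<and>
      dyck_eq m (Some (map x [r..l])) (Some (map Alpha q)))"
  using assms(2,3)
proof (induction l rule: int_ge_induct)
  case base
  then show ?case by (auto intro!: exI[of _ "[]"] dyck_eq.refl bexI[of _ "[]"])
next
  case (step l)
  define c where "c = x (l + 1)"
  have c: "c \<in> dyck_alphabet m" using x by (auto simp: c_def)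
  have word: "Some (map x [r..l + 1]) = word_mult (Some (map x [r..l])) (Some [c])"
    using step.hyps upto_rec2[of r "l + 1"] by (simp add: c_def)
  have cc: "dyck_eq m (Some [c]) (Some [c])" using c by (intro dyck_eq.refl) auto
  from step consider
      (zero) "dyck_eq m (Some (map x [r..l])) None"
    | (push) q where "q \<in> lists {1..m}"
        "int (length q) = height (skeleton x) (l + 1) - height (skeleton x) r"
        "dyck_eq m (Some (map x [r..l])) (Some (map Alpha q))"
    by fastforce
  then show ?case
  proof cases
    case zero
    then have "dyck_eq m (word_mult (Some (map x [r..l])) (Some [c])) (word_mult None (Some [c]))"
      using cc by (rule dyck_eq.mult)
    then show ?thesis by (simp add: word del: word_mult.simps(1))
  next
    case (push q)
    have w: "dyck_eq m (Some (map x [r..l + 1])) (Some (map Alpha q @ [c]))"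
      using dyck_eq.mult[OF push(3) cc] word by simp
    show ?thesis
    proof (cases c)
      case (Alpha j)
      then have "skeleton x (l + 1) = 1" by (simp add: skeleton_def c_def[symmetric])
      then have H: "height (skeleton x) (l + 1 + 1) = height (skeleton x) (l + 1) + 1"
        by (rule height_up)
      have "j \<in> {1..m}" using c Alpha by (auto simp: dyck_alphabet_def)
      with w push H show ?thesis
        by (intro disjI2 bexI[of _ "q @ [j]"]) (auto simp: Alpha)
    next
      case (Beta j)
      then have "skeleton x (l + 1) = 0" by (simp add: skeleton_def c_def[symmetric])
      then have H: "height (skeleton x) (l + 1 + 1) = height (skeleton x) (l + 1) - 1"
        by (rule height_down)
      moreover have "height (skeleton x) r \<le> height (skeleton x) (l + 1 + 1)"
        using step.hyps by (intro step.prems) auto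
      ultimately have "q \<noteq> []" using push(2) by auto
      then obtain p i where q: "q = p @ [i]" by (metis rev_exhaust)
      have j: "j \<in> {1..m}" using c Beta by (auto simp: dyck_alphabet_def)
      have i: "i \<in> {1..m}" and p: "p \<in> lists {1..m}" using push(1) q by auto
      have pp: "dyck_eq m (Some (map Alpha p)) (Some (map Alpha p))"
        using p by (intro dyck_eq.refl) (auto simp: dyck_alphabet_def)
      show ?thesis
      proof (cases "i = j")
        case True
        have "dyck_eq m (Some (map Alpha q @ [c])) (Some (map Alpha p))"
          using dyck_eq.mult[OF pp dyck_eq.match[OF j]] by (simp add: q Beta True)
        with w p H push(2) show ?thesis
          by (intro disjI2 bexI[of _ p]) (auto intro: dyck_eq.trans simp: q)
      next
        case False
        have "dyck_eq m (Some (map Alpha q @ [c])) None"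
          using dyck_eq.mult[OF pp dyck_eq.mismatch[OF i j False]] by (simp add: q Beta)
        with w show ?thesis by (blast intro: dyck_eq.trans)
      qed
    qed
  qed
qed

text \<open>The path strictly between the two positions stays at or above its starting height and
  returns to it, so the word there reduces to 1 or 0. In both cases distinct labels at the ends
  would make the whole word zero.\<close>

lemma label_epsilon_index:
  assumes x: "x \<in> dyck_shift m" and z: "recurrent (skeleton x)" and n: "skeleton x n = 0"
  shows "label x n = label x (epsilon_index n (skeleton x))"
proof (rule ccontr)
  define z where "z = skeleton x"
  define l where "l = epsilon_index n z"
  assume "label x n \<noteq> label x (epsilon_index n (skeleton x))"
  then have ne: "label x l \<noteq> label x n" by (simp add: l_def z_def)
  have l: "l < n" "height z l = height z (n + 1)" "z l = 1"
      "\<And>k. l < k \<Longrightarrow> k \<le> n \<Longrightarrow> height z (n + 1) < height z k"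
    using epsilon_index[of z n] assms by (auto simp: l_def z_def)
  have xA: "x \<in> UNIV \<rightarrow> dyck_alphabet m" using x by (simp add: dyck_shift_def)
  have rng: "label x i \<in> {1..m}" for i using label_range xA by blast
  have H: "height z (l + 1) = height z (n + 1) + 1" "height z n = height z (n + 1) + 1"
    using height_up[of z l, OF l(3)] height_down[of z n] n l(2) by (auto simp: z_def)
  have "dyck_eq m (Some (map x [l + 1..n - 1])) None \<or>
    (\<exists>q\<in>lists {1..m}. int (length q) = height z (n - 1 + 1) - height z (l + 1) \<and>
      dyck_eq m (Some (map x [l + 1..n - 1])) (Some (map Alpha q)))"
    unfolding z_def
  proof (rule excursion_word[OF xA])
    show "height (skeleton x) (l + 1) \<le> height (skeleton x) k"
      if "l + 1 \<le> k" "k \<le> n - 1 + 1" for k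
      using l(4)[of k] that H by (simp add: z_def)
  qed (use l in auto)
  then consider "dyck_eq m (Some (map x [l + 1..n - 1])) None"
    | "dyck_eq m (Some (map x [l + 1..n - 1])) (Some [])"
    using H by auto
  moreover have split: "map x [l..n] = [x l] @ map x [l + 1..n - 1] @ [x n]"
    using l(1) upto_rec1[of l n] upto_rec2[of "l + 1" n] by simp
  have xx: "dyck_eq m (Some [x i]) (Some [x i])" for i
    using xA by (intro dyck_eq.refl) auto
  have split': "Some (map x [l..n]) =
      word_mult (Some [x l]) (word_mult (Some (map x [l + 1..n - 1])) (Some [x n]))"
    by (simp add: split)
  moreover have "x l = Alpha (label x l)" "x n = Beta (label x n)"
    using letter_eq[of x l] letter_eq[of x n] l(3) n by (auto simp: z_def)
  then have "dyck_eq m (Some ([x l] @ [x n])) None"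
    using dyck_eq.mismatch[OF rng rng ne] by simp
  ultimately have "dyck_eq m (Some (map x [l..n])) None"
  proof cases
    case 1
    show ?thesis using dyck_eq.mult[OF xx dyck_eq.mult[OF 1 xx]] by (simp add: split)
  next
    case 2
    have "dyck_eq m (Some (map x [l..n])) (Some ([x l] @ [x n]))"
      using dyck_eq.mult[OF xx dyck_eq.mult[OF 2 xx]] by (simp add: split)
    then show ?thesis using \<open>dyck_eq m (Some ([x l] @ [x n])) None\<close> by (rule dyck_eq.trans)
  qed
  moreover have "map x [l..n] \<in> dyck_language m" using x l(1) by (simp add: dyck_shift_def)
  ultimately show False by (simp add: dyck_language_def)
qed

text \<open>Labels at zeros of \<open>z\<close> are never read, because \<open>epsilon_index\<close>
  always points to a one.\<close>

lemma code_cong: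
  assumes "recurrent z" "\<And>i. z i = 1 \<Longrightarrow> b i = b' i"
  shows "code (z, b) = code (z, b')"
proof
  fix n
  show "code (z, b) n = code (z, b') n"
    using assms epsilon_index(3)[of z n] recurrent_binary[of z n] by (auto simp: code_def)
qed

lemma code_skeleton_label:
  assumes "x \<in> dyck_shift m" "recurrent (skeleton x)"
  shows "code (skeleton x, label x) = x"
proof
  fix n
  show "code (skeleton x, label x) n = x n"
    using label_epsilon_index[OF assms, of n] letter_eq[of x n] recurrent_binary[OF assms(2), of n]
    by (auto simp: code_def)
qed

section \<open>Measurability\<close>

lemma measurable_count_space_subset:
  assumes "f \<in> M \<rightarrow>\<^sub>M count_space UNIV" "f \<in> space M \<rightarrow> A"
  shows "f \<in> M \<rightarrow>\<^sub>M count_space A"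
proof (rule measurableI)
  show "f -` X \<inter> space M \<in> sets M" for X
    using assms(1) by (rule measurable_sets) simp
qed (use assms(2) in auto)

lemma measurable_countable_op:
  fixes f :: "'a \<Rightarrow> 'b::countable" and g :: "'a \<Rightarrow> 'c::countable"
  assumes [measurable]: "f \<in> M \<rightarrow>\<^sub>M count_space UNIV" "g \<in> M \<rightarrow>\<^sub>M count_space UNIV"
  shows "(\<lambda>x. h (f x) (g x)) \<in> M \<rightarrow>\<^sub>M count_space UNIV"
proof -
  have "(\<lambda>x. h i (g x)) \<in> M \<rightarrow>\<^sub>M count_space UNIV" for i by measurable
  from measurable_compose_countable[OF this assms(1)] show ?thesis .
qed

lemma measurable_sum_int:
  fixes f :: "'i \<Rightarrow> 'a \<Rightarrow> int"
  assumes "\<And>i. f i \<in> M \<rightarrow>\<^sub>M count_space UNIV"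
  shows "(\<lambda>x. \<Sum>i\<in>J. f i x) \<in> M \<rightarrow>\<^sub>M count_space UNIV"
proof (induction J rule: infinite_finite_induct)
  case (insert i J)
  have "(\<lambda>x. f i x + (\<Sum>i\<in>J. f i x)) \<in> M \<rightarrow>\<^sub>M count_space UNIV"
    by (rule measurable_countable_op) (fact assms insert)+
  then show ?case using insert by simp
qed auto

lemma measurable_PiM_count_space_component:
  assumes "sets N = sets (count_space A)"
  shows "(\<lambda>x. x i) \<in> PiM UNIV (\<lambda>_. N) \<rightarrow>\<^sub>M count_space UNIV"
proof -
  have "(\<lambda>x. x i) \<in> PiM UNIV (\<lambda>_. N) \<rightarrow>\<^sub>M count_space A"
    unfolding measurable_cong_sets[OF HOL.refl assms[symmetric]]
    by (rule measurable_component_singleton) simp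
  then show ?thesis by (rule measurable_compose) simp
qed

lemma measurable_mu1_component [measurable]: "(\<lambda>z. z i) \<in> mu1 \<rightarrow>\<^sub>M count_space UNIV"
  unfolding mu1_def
  by (rule measurable_PiM_count_space_component[OF sets_uniform_count_measure_count_space])

lemma measurable_mu2_component [measurable]: "(\<lambda>a. a i) \<in> mu2 m \<rightarrow>\<^sub>M count_space UNIV"
  unfolding mu2_def
  by (rule measurable_PiM_count_space_component[OF sets_uniform_count_measure_count_space])

lemma space_mu1: "space mu1 = UNIV \<rightarrow> {0, 1}"
  by (simp add: mu1_def space_PiM space_uniform_count_measure PiE_UNIV_domain Pi_def)

lemma space_mu2: "space (mu2 m) = UNIV \<rightarrow> {1..m}"
  by (simp add: mu2_def space_PiM space_uniform_count_measure PiE_UNIV_domain Pi_def)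

lemma prob_space_mu1: "prob_space mu1"
  unfolding mu1_def by (intro prob_space_PiM prob_space_uniform_count_measure) auto

lemma prob_space_mu2: "m \<ge> 1 \<Longrightarrow> prob_space (mu2 m)"
  unfolding mu2_def by (intro prob_space_PiM prob_space_uniform_count_measure) auto

lemma measurable_mu2I:
  assumes "\<And>i. (\<lambda>x. f x i) \<in> M \<rightarrow>\<^sub>M count_space UNIV" "f \<in> space M \<rightarrow> UNIV \<rightarrow> {1..m}"
  shows "f \<in> M \<rightarrow>\<^sub>M mu2 m"
  unfolding mu2_def
proof (rule measurable_PiM_single')
  fix i
  have "(\<lambda>x. f x i) \<in> M \<rightarrow>\<^sub>M count_space {1..m}"
    using assms(2) by (intro measurable_count_space_subset[OF assms(1)]) auto
  then show "(\<lambda>x. f x i) \<in> M \<rightarrow>\<^sub>M uniform_count_measure {1..m}"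
    by (subst measurable_cong_sets[OF HOL.refl sets_uniform_count_measure_count_space])
qed (use assms(2) in \<open>auto simp: space_uniform_count_measure PiE_UNIV_domain Pi_def\<close>)

lemma measurable_height [measurable]: "(\<lambda>z. height z i) \<in> mu1 \<rightarrow>\<^sub>M count_space UNIV"
  unfolding height_def by (intro measurable_If measurable_sum_int) measurable

lemma measurable_gamma_index [measurable]: "(\<lambda>z. gamma_index i z) \<in> mu1 \<rightarrow>\<^sub>M count_space UNIV"
proof -
  have "(\<lambda>z. \<Sum>j\<in>J. int (z j)) \<in> mu1 \<rightarrow>\<^sub>M count_space UNIV" for J
    by (rule measurable_sum_int) measurable
  then show ?thesis
    unfolding gamma_index_def by (intro measurable_If) (auto intro: measurable_compose)
qed

lemma measurable_height_le [measurable]: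
  "Measurable.pred mu1 (\<lambda>z. height z i \<le> t)"
  "Measurable.pred mu1 (\<lambda>z. height z i \<le> height z j + t)"
proof -
  show "Measurable.pred mu1 (\<lambda>z. height z i \<le> t)"
    by (rule measurable_compose[OF measurable_height]) simp
  show "Measurable.pred mu1 (\<lambda>z. height z i \<le> height z j + t)"
    by (rule measurable_countable_op[of _ _ _ "\<lambda>a b. a \<le> b + t"]) measurable
qed

text \<open>\<open>GREATEST\<close> is a definite description; a maximum is unique, and there are
  only countably many candidates.\<close>

lemma measurable_Greatest_int:
  fixes P :: "int \<Rightarrow> 'a \<Rightarrow> bool"
  assumes [measurable]: "\<And>i. Measurable.pred M (P i)"
  shows "(\<lambda>x. GREATEST i. P i x) \<in> M \<rightarrow>\<^sub>M count_space UNIV"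
  unfolding Greatest_def by (rule measurable_THE[where I = UNIV]) (measurable, auto intro: antisym)

lemma measurable_last_visit [measurable]:
  "(\<lambda>z. last_visit z n t) \<in> mu1 \<rightarrow>\<^sub>M count_space UNIV"
  unfolding last_visit_def by (rule measurable_Greatest_int) measurable

lemma measurable_epsilon_index [measurable]:
  "(\<lambda>z. epsilon_index n z) \<in> mu1 \<rightarrow>\<^sub>M count_space UNIV"
  unfolding epsilon_index_def using measurable_height_le(2)[where t = 0]
  by (intro measurable_Greatest_int) simp

text \<open>Evaluation at a random position is glued from the countably many coordinate
  evaluations.\<close>

lemma measurable_pair_mu2:
  assumes [measurable]: "(\<lambda>z. k z) \<in> mu1 \<rightarrow>\<^sub>M count_space (UNIV :: int set)"
  shows "(\<lambda>p. snd p (k (fst p))) \<in> mu1 \<Otimes>\<^sub>M mu2 m \<rightarrow>\<^sub>M count_space UNIV"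
proof (rule measurable_compose_countable[where f = "\<lambda>i p. snd p i" and g = "\<lambda>p. k (fst p)"])
  show "(\<lambda>p. snd p i) \<in> mu1 \<Otimes>\<^sub>M mu2 m \<rightarrow>\<^sub>M count_space UNIV" for i
    by (rule measurable_compose[OF measurable_snd measurable_mu2_component])
qed measurable

lemma space_dyck_borel: "space (dyck_borel m) = dyck_shift m"
  by (auto simp: dyck_borel_def space_restrict_space space_PiM dyck_shift_def)

lemma measurable_dyck_borelI:
  assumes "\<And>i. (\<lambda>x. f x i) \<in> M \<rightarrow>\<^sub>M count_space UNIV" "f \<in> space M \<rightarrow> dyck_shift m"
  shows "f \<in> M \<rightarrow>\<^sub>M dyck_borel m"
  unfolding dyck_borel_def
proof (intro measurable_restrict_space2 assms(2) measurable_PiM_single')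
  show "(\<lambda>x. f x i) \<in> M \<rightarrow>\<^sub>M count_space (dyck_alphabet m)" for i
    using assms(2) by (intro measurable_count_space_subset[OF assms(1)]) (auto simp: dyck_shift_def)
qed (use assms(2) in \<open>auto simp: dyck_shift_def\<close>)

lemma measurable_dyck_component [measurable]:
  "(\<lambda>x. x i) \<in> dyck_borel m \<rightarrow>\<^sub>M count_space UNIV"
  unfolding dyck_borel_def
  by (rule measurable_restrict_space1)
    (rule measurable_PiM_count_space_component[OF HOL.refl])

lemma measurable_code [measurable]: "code \<in> mu1 \<Otimes>\<^sub>M mu2 m \<rightarrow>\<^sub>M dyck_borel m"
proof (rule measurable_dyck_borelI)
  fix n
  have "(\<lambda>p. snd p n) \<in> mu1 \<Otimes>\<^sub>M mu2 m \<rightarrow>\<^sub>M count_space UNIV"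
    "(\<lambda>p. snd p (epsilon_index n (fst p))) \<in> mu1 \<Otimes>\<^sub>M mu2 m \<rightarrow>\<^sub>M count_space UNIV"
    by (rule measurable_pair_mu2; measurable)+
  from this[THEN measurable_compose, of Alpha] this[THEN measurable_compose, of Beta]
  have [measurable]: "(\<lambda>p. Alpha (snd p n)) \<in> mu1 \<Otimes>\<^sub>M mu2 m \<rightarrow>\<^sub>M count_space UNIV"
    "(\<lambda>p. Beta (snd p (epsilon_index n (fst p)))) \<in> mu1 \<Otimes>\<^sub>M mu2 m \<rightarrow>\<^sub>M count_space UNIV"
    by simp_all
  have [measurable]: "Measurable.pred (mu1 \<Otimes>\<^sub>M mu2 m) (\<lambda>p. fst p n = 1)"
    by (rule measurable_compose[OF measurable_compose[OF measurable_fst measurable_mu1_component]]) simp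
  show "(\<lambda>p. code p n) \<in> mu1 \<Otimes>\<^sub>M mu2 m \<rightarrow>\<^sub>M count_space UNIV"
    unfolding code_def case_prod_unfold by measurable
qed (use code_in_dyck_shift in \<open>auto simp: space_pair_measure space_mu1 space_mu2 simp del: One_nat_def\<close>)

lemma sets_recurrent [measurable]: "Measurable.pred mu1 recurrent"
proof -
  have "recurrent z \<longleftrightarrow> (\<forall>K N. \<exists>n. n \<ge> N \<and> height z n \<le> K) \<and> (\<forall>K N. \<exists>n. n \<le> N \<and> height z n \<le> K)"
    if "z \<in> space mu1" for z
    using that by (auto simp: recurrent_def space_mu1)
  then show ?thesis by (subst measurable_cong) (assumption, measurable)
qed

section \<open>Recurrence of the simple random walk\<close>

text \<open>The letter \<open>c\<close> that counts as a step up is a parameter because the height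
  read from the origin to the left goes up at zeros and down at ones.\<close>

definition walk :: "nat \<Rightarrow> nat stream \<Rightarrow> nat \<Rightarrow> int" where
  "walk c s n = (\<Sum>i<n. if s !! i = c then 1 else -1)"

lemma walk_Stream: "walk c (t ## s) (Suc n) = (if t = c then 1 else -1) + walk c s n"
  by (simp add: walk_def sum.lessThan_Suc_shift del: sum.lessThan_Suc)

text \<open>The probability \<open>p h\<close> that the walk from height \<open>h\<close> stays positive is harmonic with
  \<open>p 0 = 0\<close>, so \<open>p h = h * p 1\<close>; being bounded, it vanishes.\<close>

lemma AE_walk_hits:
  fixes c :: nat
  assumes c: "c \<in> {0, 1}"
  shows "AE s in stream_space (uniform_count_measure {0, 1}). \<exists>n. int h + walk c s n \<le> 0"
proof -
  define M :: "nat measure" where "M = uniform_count_measure {0, 1}"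
  interpret M: prob_space M
    unfolding M_def by (rule prob_space_uniform_count_measure) auto
  interpret S: prob_space "stream_space M" by (rule M.prob_space_stream_space)
  have "id \<in> M \<rightarrow>\<^sub>M count_space UNIV"
    by (rule measurableI) (auto simp: M_def space_uniform_count_measure sets_uniform_count_measure)
  from measurable_compose[OF measurable_snth this]
  have [measurable]: "(\<lambda>s. s !! i) \<in> stream_space M \<rightarrow>\<^sub>M count_space UNIV" for i by simp
  define Q where "Q h s \<longleftrightarrow> (\<forall>n. 0 < int h + walk c s n)" for h s
  have wm [measurable]: "(\<lambda>s. walk c s n) \<in> stream_space M \<rightarrow>\<^sub>M count_space UNIV" for n
    unfolding walk_def by (intro measurable_sum_int) measurable
  have Qm [measurable]: "Measurable.pred (stream_space M) (Q h)" for h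
    unfolding Q_def by (intro pred_intros_countable) (rule measurable_compose[OF wm], simp)
  define p where "p h = \<P>(s in stream_space M. Q h s)" for h
  have p_nonneg: "0 \<le> p h" for h by (simp add: p_def)
  have nn: "(\<integral>\<^sup>+t. ennreal (g t) \<partial>M) = ennreal ((g 0 + g 1) / 2)" if "\<And>t. 0 \<le> g t" for g
  proof -
    have "(\<integral>\<^sup>+t. ennreal (g t) \<partial>M) = (\<Sum>t\<in>{0, 1}. ennreal (1 / 2) * ennreal (g t))"
      unfolding M_def uniform_count_measure_def
      by (subst nn_integral_point_measure_finite) simp_all
    also have "\<dots> = (\<Sum>t\<in>{0, 1}. ennreal (1 / 2 * g t))"
      by (intro sum.cong HOL.refl ennreal_mult[symmetric] that) simp
    also have "\<dots> = ennreal (\<Sum>t\<in>{0, 1}. 1 / 2 * g t)"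
      by (intro sum_ennreal) (simp add: that)
    finally show ?thesis by (simp add: add_divide_distrib)
  qed
  have Q0: "\<not> Q 0 s" for s unfolding Q_def by (auto simp: walk_def intro!: exI[of _ 0])
  have QS: "Q (Suc h) (t ## s) \<longleftrightarrow> Q (if t = c then Suc (Suc h) else h) s" for h t s
  proof -
    have "(\<forall>n. 0 < int (Suc h) + walk c (t ## s) n) \<longleftrightarrow>
      0 < int (Suc h) + walk c (t ## s) 0 \<and> (\<forall>n. 0 < int (Suc h) + walk c (t ## s) (Suc n))"
      by (metis not0_implies_Suc)
    then show ?thesis by (simp add: Q_def walk_Stream) (simp add: walk_def algebra_simps)
  qed
  \<comment> \<open>Conditioning on the first letter of the stream.\<close>
  have "ennreal (p (Suc h)) = (\<integral>\<^sup>+t. \<P>(s in stream_space M. Q (Suc h) (t ## s)) \<partial>M)" for h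
    unfolding p_def by (rule M.prob_stream_space) measurable
  also have "\<dots> h = (\<integral>\<^sup>+t. p (if t = c then Suc (Suc h) else h) \<partial>M)" for h
    by (simp add: QS p_def)
  also have "\<dots> h = ennreal ((p h + p (Suc (Suc h))) / 2)" for h
    using c by (subst nn) (auto simp: p_nonneg add.commute)
  finally have harm: "p (Suc h) = (p h + p (Suc (Suc h))) / 2" for h
    by (subst (asm) ennreal_inj) (auto simp: p_def)
  have p0: "p 0 = 0" using Q0 by (simp add: p_def)
  have lin: "p h = h * p 1 \<and> p (Suc h) = Suc h * p 1" for h
  proof (induction h)
    case (Suc h)
    then show ?case using harm[of h] by (simp add: algebra_simps)
  qed (simp add: p0)
  have "p 1 = 0"
  proof (rule ccontr)
    assume "p 1 \<noteq> 0"
    then have "p 1 > 0" using p_nonneg[of 1] by linarith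
    then obtain n :: nat where "1 < real n * p 1" using reals_Archimedean3 by blast
    then have "1 < p n" using lin[of n] by linarith
    moreover have "p n \<le> 1" unfolding p_def by (rule S.prob_le_1)
    ultimately show False by linarith
  qed
  with lin[of h] have "p h = 0" by simp
  then have "AE s in stream_space M. \<not> Q h s"
    unfolding p_def by (subst (asm) S.prob_Collect_eq_0) simp_all
  then show ?thesis unfolding Q_def M_def by (simp add: not_less)
qed

lemma measurable_mu1_reindex:
  "(\<lambda>z n. z (f n)) \<in> mu1 \<rightarrow>\<^sub>M PiM UNIV (\<lambda>_. uniform_count_measure {0, 1})"
  unfolding mu1_def by (rule measurable_PiM_single') (auto simp: space_PiM PiE_UNIV_domain)

lemmas measurable_mu1_stream = measurable_compose[OF measurable_mu1_reindex measurable_to_stream]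

text \<open>Distinct coordinates of an i.i.d. family are again i.i.d.; this carries the hitting
  statement for one-sided streams to each half of \<open>z\<close>.\<close>

lemma distr_mu1_stream:
  fixes f :: "nat \<Rightarrow> int"
  assumes "inj f"
  shows "distr mu1 (stream_space (uniform_count_measure {0, 1})) (\<lambda>z. to_stream (\<lambda>n. z (f n)))
    = stream_space (uniform_count_measure {0, 1})"
proof -
  let ?M = "uniform_count_measure {0, 1 :: nat}"
  have P: "distr mu1 (PiM UNIV (\<lambda>_. ?M)) (\<lambda>z n. z (f n)) = PiM UNIV (\<lambda>_. ?M)"
    unfolding mu1_def
    using distr_PiM_reindex[of UNIV "\<lambda>_. ?M" f UNIV] prob_space_uniform_count_measure[of "{0, 1 :: nat}"] assms
    by (simp add: restrict_UNIV)
  show ?thesis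
    by (subst (2) stream_space_eq_distr, subst P[symmetric], subst distr_distr[OF measurable_to_stream measurable_mu1_reindex])
       (auto simp: comp_def)
qed

lemma AE_height_unbounded:
  "AE z in mu1. (\<forall>h. \<exists>n. height z (int n) \<le> - int h) \<and> (\<forall>h. \<exists>n. height z (- int n) \<le> - int h)"
proof -
  let ?M = "uniform_count_measure {0, 1 :: nat}"
  have R: "height z (int n) = walk 1 (to_stream (\<lambda>n. z (int n))) n"
    if "z \<in> space mu1" for z n
  proof (induction n)
    case (Suc n)
    have "z (int n) = 0 \<or> z (int n) = 1" using that by (auto simp: space_mu1)
    then show ?case using Suc height_step[of z "int n"]
      by (auto simp: walk_def to_stream_def add.commute)
  qed (simp add: walk_def)
  have L: "height z (- int n) = walk 0 (to_stream (\<lambda>n. z (- 1 - int n))) n"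
    if "z \<in> space mu1" for z n
  proof (induction n)
    case (Suc n)
    have "z (- 1 - int n) = 0 \<or> z (- 1 - int n) = 1" using that by (auto simp: space_mu1)
    then show ?case using Suc height_step[of z "- 1 - int n"]
      by (auto simp: walk_def to_stream_def)
  qed (simp add: walk_def)
  have hit: "AE z in mu1. \<exists>n. int h + walk c (to_stream (\<lambda>n. z (f n))) n \<le> 0"
    if "inj f" "c \<in> {0, 1}" for f h c
    using AE_walk_hits[OF that(2), of h]
    by (subst (asm) distr_mu1_stream[OF that(1), symmetric])
       (rule AE_distrD[OF measurable_mu1_stream])
  have "AE z in mu1. (\<forall>h. \<exists>n. int h + walk 1 (to_stream (\<lambda>n. z (int n))) n \<le> 0)"
    "AE z in mu1. (\<forall>h. \<exists>n. int h + walk 0 (to_stream (\<lambda>n. z (- 1 - int n))) n \<le> 0)"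
    unfolding AE_all_countable by (auto intro!: hit injI)
  then show ?thesis
    using AE_space
    by eventually_elim (simp add: R[symmetric] L[symmetric] algebra_simps del: One_nat_def, smt (verit))
qed

lemma AE_recurrent: "AE z in mu1. recurrent z"
  using AE_height_unbounded AE_space
proof eventually_elim
  case (elim z)
  have "\<exists>n\<ge>N. height z n \<le> K" for K N
  proof -
    \<comment> \<open>A low position is also a distant one: heights are bounded by the distance to
      the origin, so this level forces both \<open>n \<ge> N\<close> and a height of at most
      \<open>K\<close>.\<close>
    obtain n where n: "height z (int n) \<le> - int (nat (\<bar>N\<bar> + \<bar>K\<bar>))" using elim by blast
    with height_abs_le[of z "int n"] show ?thesis by (intro exI[of _ "int n"]) auto
  qed
  moreover have "\<exists>n\<le>N. height z n \<le> K" for K N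
  proof -
    obtain n where n: "height z (- int n) \<le> - int (nat (\<bar>N\<bar> + \<bar>K\<bar>))" using elim by blast
    with height_abs_le[of z "- int n"] show ?thesis by (intro exI[of _ "- int n"]) auto
  qed
  ultimately show ?case using elim by (simp add: recurrent_def space_mu1)
qed

section \<open>Labelling by position\<close>

lemma measurable_relabel:
  "(\<lambda>p. (fst p, \<lambda>l. snd p (gamma_index l (fst p)))) \<in> mu1 \<Otimes>\<^sub>M mu2 m \<rightarrow>\<^sub>M mu1 \<Otimes>\<^sub>M mu2 m"
proof (rule measurable_Pair)
  show "(\<lambda>p. \<lambda>l. snd p (gamma_index l (fst p))) \<in> mu1 \<Otimes>\<^sub>M mu2 m \<rightarrow>\<^sub>M mu2 m"
    by (rule measurable_mu2I[OF measurable_pair_mu2[OF measurable_gamma_index]])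
      (auto simp: space_pair_measure space_mu2)
qed simp

lemma measurable_coding [measurable]: "coding \<in> mu1 \<Otimes>\<^sub>M mu2 m \<rightarrow>\<^sub>M dyck_borel m"
  using measurable_compose[OF measurable_relabel measurable_code]
  by (simp add: coding_eq_code[symmetric])

text \<open>Each one counts itself in its own sum, so the ones at nonnegative positions get the
  indices 1, 2, ... and those at negative positions -1, -2, ... going left; the index 0 is
  skipped.\<close>

lemma strict_mono_on_gamma_index:
  "strict_mono_on {n. z n = 1} (\<lambda>n. gamma_index n z)"
proof (rule strict_mono_onI)
  fix i j :: int
  assume "i \<in> {n. z n = 1}" "j \<in> {n. z n = 1}" "i < j"
  then have ij: "z i = 1" "z j = 1" "i < j" by auto
  have less: "(\<Sum>k\<in>A. int (z k)) < (\<Sum>k\<in>B. int (z k))"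
    if "A \<subseteq> B" "finite B" "l \<in> B - A" "z l = 1" for A B l
  proof -
    have "(\<Sum>k\<in>insert l A. int (z k)) \<le> (\<Sum>k\<in>B. int (z k))"
      by (rule sum_mono2) (use that in auto)
    then show ?thesis using that by (simp add: finite_subset)
  qed
  consider "i \<ge> 0" | "i < 0" "j \<ge> 0" | "j < 0" by linarith
  then show "gamma_index i z < gamma_index j z"
  proof cases
    case 1
    then show ?thesis using ij less[of "{0..i}" "{0..j}" j] by (auto simp: gamma_index_def)
  next
    case 2
    then show ?thesis using ij less[of "{}" "{i..-1}" i] less[of "{}" "{0..j}" j]
      by (auto simp: gamma_index_def)
  next
    case 3
    then show ?thesis using ij less[of "{j..-1}" "{i..-1}" i] by (auto simp: gamma_index_def)
  qed
qed

lemma recurrent_space: "recurrent z \<Longrightarrow> z \<in> space mu1"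
  by (simp add: recurrent_def space_mu1)

text \<open>Only the labels at the positions of the ones of \<open>z\<close> matter; they are read by \<open>coding\<close>
  along an injection, hence independent and uniform, and may as well be attached to the positions.\<close>

lemma emeasure_coding_section:
  assumes m: "m \<ge> 1" and z: "recurrent z" and C: "C \<in> sets (dyck_borel m)"
  shows "emeasure (mu2 m) {a \<in> space (mu2 m). coding (z, a) \<in> C}
    = emeasure (mu2 m) {b \<in> space (mu2 m). code (z, b) \<in> C}"
proof -
  define I where "I = {n. z n = 1}"
  let ?M = "uniform_count_measure {1..m}"
  let ?PI = "PiM I (\<lambda>_. ?M)"
  have zspace: "z \<in> space mu1" using z by (rule recurrent_space)
  \<comment> \<open>Labels off \<open>I\<close> get the default 1, a legal label because
    \<open>m \<ge> 1\<close>; by \<open>code_cong\<close> they are never read.\<close>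
  define ext where "ext w = (\<lambda>i. if i \<in> I then w i else (1::nat))" for w :: "int \<Rightarrow> nat"
  have ext: "ext \<in> ?PI \<rightarrow>\<^sub>M mu2 m"
    unfolding mu2_def ext_def
  proof (rule measurable_PiM_single')
    fix i
    show "(\<lambda>w. if i \<in> I then w i else 1) \<in> ?PI \<rightarrow>\<^sub>M ?M"
      using m by (cases "i \<in> I") (auto simp: space_uniform_count_measure)
  qed (use m in \<open>auto simp: space_PiM space_uniform_count_measure PiE_UNIV_domain PiE_iff\<close>)
  define W where "W = {w \<in> space ?PI. code (z, ext w) \<in> C}"
  have "(\<lambda>w. code (z, ext w)) \<in> ?PI \<rightarrow>\<^sub>M dyck_borel m"
    by (rule measurable_compose[OF measurable_Pair[OF measurable_const[OF zspace] ext] measurable_code])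
  then have W: "W \<in> sets ?PI" unfolding W_def using C by measurable
  \<comment> \<open>Stated for every injective reading \<open>f\<close>: \<open>gamma_index\<close>
    and the identity give the two sides of the claim, and both have the measure of
    \<open>W\<close>.\<close>
  have law: "emeasure (mu2 m) {a \<in> space (mu2 m). code (z, \<lambda>l. a (f l)) \<in> C} = emeasure ?PI W"
    if "inj_on f I" for f
  proof -
    have "distr (mu2 m) ?PI (\<lambda>a. \<lambda>n\<in>I. a (f n)) = ?PI"
      unfolding mu2_def using that m
      by (intro distr_PiM_reindex prob_space_uniform_count_measure) auto
    then have "emeasure ?PI W = emeasure (distr (mu2 m) ?PI (\<lambda>a. \<lambda>n\<in>I. a (f n))) W" by simp
    also have "\<dots> = emeasure (mu2 m) ((\<lambda>a. \<lambda>n\<in>I. a (f n)) -` W \<inter> space (mu2 m))"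
      using W by (intro emeasure_distr) (auto simp: mu2_def)
    also have "(\<lambda>a. \<lambda>n\<in>I. a (f n)) -` W \<inter> space (mu2 m)
        = {a \<in> space (mu2 m). code (z, \<lambda>l. a (f l)) \<in> C}"
    proof -
      have "code (z, ext (\<lambda>n\<in>I. a (f n))) = code (z, \<lambda>l. a (f l))" for a
        by (rule code_cong[OF z]) (simp add: ext_def I_def)
      then show ?thesis
        by (auto simp: W_def space_PiM space_uniform_count_measure space_mu2)
    qed
    finally show ?thesis by simp
  qed
  have "inj_on (\<lambda>n. gamma_index n z) I"
    unfolding I_def by (rule strict_mono_on_imp_inj_on[OF strict_mono_on_gamma_index])
  from law[OF this] law[OF inj_on_id2] show ?thesis by (simp add: coding_eq_code)
qed

text \<open>The two codings differ as maps and agree only in law for fixed \<open>z\<close>. Fubini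
  therefore compares sections: those at recurrent \<open>z\<close> by
  \<open>emeasure_coding_section\<close>, all others being empty.\<close>

lemma emeasure_mu_tilde:
  assumes m: "m \<ge> 1" and C: "C \<in> sets (dyck_borel m)"
  shows "emeasure (mu_tilde m) C =
    emeasure (mu1 \<Otimes>\<^sub>M mu2 m) {p \<in> space (mu1 \<Otimes>\<^sub>M mu2 m). recurrent (fst p) \<and> code p \<in> C}"
proof -
  let ?P = "mu1 \<Otimes>\<^sub>M mu2 m" and ?S = "S_minus_minus \<times> space (mu2 m)"
  interpret mu2: prob_space "mu2 m" using m by (rule prob_space_mu2)
  have S_eq: "?S = {p \<in> space ?P. recurrent (fst p)}"
    by (auto simp: S_minus_minus_eq space_pair_measure dest: recurrent_space)
  have Sm: "?S \<in> sets ?P" unfolding S_eq by measurable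
  have meas: "{p \<in> space ?P. recurrent (fst p) \<and> f p \<in> C} \<in> sets ?P"
    if "f \<in> ?P \<rightarrow>\<^sub>M dyck_borel m" for f
    using that C by measurable
  have "emeasure (mu_tilde m) C = emeasure (restrict_space ?P ?S) (coding -` C \<inter> space (restrict_space ?P ?S))"
    unfolding mu_tilde_def
    by (rule emeasure_distr[OF measurable_restrict_space1[OF measurable_coding] C])
  also have "coding -` C \<inter> space (restrict_space ?P ?S) = {p \<in> space ?P. recurrent (fst p) \<and> coding p \<in> C}"
    unfolding space_restrict_space S_eq by auto
  also have "emeasure (restrict_space ?P ?S) \<dots> = emeasure ?P \<dots>"
    by (rule emeasure_restrict_space) (use Sm in \<open>auto simp: S_eq\<close>)
  also have "\<dots> = emeasure ?P {p \<in> space ?P. recurrent (fst p) \<and> code p \<in> C}"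
    unfolding mu2.emeasure_pair_measure_alt[OF meas[OF measurable_coding]]
      mu2.emeasure_pair_measure_alt[OF meas[OF measurable_code]]
  proof (rule nn_integral_cong)
    fix z assume z: "z \<in> space mu1"
    have "Pair z -` {p \<in> space ?P. recurrent (fst p) \<and> f p \<in> C} =
      (if recurrent z then {b \<in> space (mu2 m). f (z, b) \<in> C} else {})" for f
      using z by (auto simp: space_pair_measure)
    then show "emeasure (mu2 m) (Pair z -` {p \<in> space ?P. recurrent (fst p) \<and> coding p \<in> C})
      = emeasure (mu2 m) (Pair z -` {p \<in> space ?P. recurrent (fst p) \<and> code p \<in> C})"
      using emeasure_coding_section[OF m _ C] by simp
  qed
  finally show ?thesis .
qed

lemma prob_space_mu_tilde:
  assumes m: "m \<ge> 1"
  shows "prob_space (mu_tilde m)"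
proof -
  let ?P = "mu1 \<Otimes>\<^sub>M mu2 m" and ?S = "S_minus_minus \<times> space (mu2 m)"
  interpret mu1: prob_space mu1 by (rule prob_space_mu1)
  interpret mu2: prob_space "mu2 m" using m by (rule prob_space_mu2)
  interpret P: pair_prob_space mu1 "mu2 m" ..
  have S_eq: "S_minus_minus = {z \<in> space mu1. recurrent z}"
    by (auto simp: S_minus_minus_eq dest: recurrent_space)
  have S1: "S_minus_minus \<in> sets mu1" unfolding S_eq by measurable
  have "emeasure mu1 S_minus_minus = 1"
    using mu1.emeasure_eq_1_AE[OF S1] AE_recurrent by (simp add: S_minus_minus_eq)
  then have "emeasure ?P ?S = 1"
    using S1 by (simp add: mu2.emeasure_pair_measure_Times mu2.emeasure_space_1)
  then interpret R: prob_space "restrict_space ?P ?S"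
    using S1 by (intro prob_space_restrict_space) auto
  show ?thesis
    unfolding mu_tilde_def
    by (rule R.prob_space_distr[OF measurable_restrict_space1[OF measurable_coding]])
qed

section \<open>Changing finitely many letters\<close>

text \<open>On each side of the changed window the height moves by a constant, which does not affect
  unboundedness below.\<close>

lemma recurrent_finite_change:
  assumes z: "recurrent z" and z': "z' \<in> UNIV \<rightarrow> {0, 1}"
    and eq: "\<And>k. \<bar>k\<bar> > N \<Longrightarrow> z k = z' k"
  shows "recurrent z'"
  unfolding recurrent_def
proof (intro conjI allI z')
  fix K M :: int
  define R where "R = \<bar>N\<bar> + 1"
  define c where "c = height z' R - height z R"
  obtain n where "n \<ge> max M R" "height z n \<le> K - c" using z unfolding recurrent_def by blast
  moreover have "height z' n = height z n + c" if "n \<ge> R" for n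
    unfolding c_def using that by (intro height_shift_right eq) (auto simp: R_def)
  ultimately show "\<exists>n\<ge>M. height z' n \<le> K" by (intro exI[of _ n]) auto
  define c where "c = height z' (- R) - height z (- R)"
  obtain n where "n \<le> min M (- R)" "height z n \<le> K - c" using z unfolding recurrent_def by blast
  moreover have "height z' n = height z n + c" if "n \<le> - R" for n
    unfolding c_def using that by (intro height_shift_left eq) (auto simp: R_def)
  ultimately show "\<exists>n\<le>M. height z' n \<le> K" by (intro exI[of _ n]) auto
qed

text \<open>The first passage to the right of the block through the level \<open>-j\<close> is matched, in \<open>x\<close>, with
  the last visit to the level \<open>-j\<close> to the left of the block, and in \<open>x'\<close> with the last visit to
  the level \<open>-j + D\<close>. Both copies carry the same letter there.\<close>

lemma label_shift:
  fixes N :: int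
  assumes x: "x \<in> dyck_shift m" and x': "x' \<in> dyck_shift m"
    and z: "recurrent (skeleton x)" and N: "N \<ge> 0"
    and eq: "\<And>k. \<bar>k\<bar> > N \<Longrightarrow> x k = x' k"
  defines "D \<equiv> (height (skeleton x') (N + 1) - height (skeleton x') (- N))
    - (height (skeleton x) (N + 1) - height (skeleton x) (- N))"
  assumes j: "j \<ge> 10 * N + 10"
  shows "label x (last_visit (skeleton x) 0 (- j)) = label x (last_visit (skeleton x) 0 (- j + D))"
proof -
  define z z' where "z = skeleton x" and "z' = skeleton x'"
  \<comment> \<open>\<open>c1\<close> and \<open>c2\<close> are the vertical displacements of the
    left and the right half. Heights are normalised at 0, inside the block, so both may be nonzero;
    the displacement of the halves against each other is \<open>D\<close>.\<close>
  define c1 where "c1 = height z' (- N) - height z (- N)"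
  define c2 where "c2 = height z' (N + 1) - height z (N + 1)"
  have D: "D = c2 - c1" by (simp add: D_def c1_def c2_def z_def z'_def)
  have zeq: "z k = z' k" if "\<bar>k\<bar> > N" for k
    using eq[OF that] by (simp add: z_def z'_def skeleton_def)
  have rz: "recurrent z" using z by (simp add: z_def)
  have rz': "recurrent z'"
    using recurrent_finite_change[OF rz _ zeq] skeleton_binary by (simp add: z'_def)
  have left: "height z' k = height z k + c1" if "k \<le> - N" for k
    unfolding c1_def using that by (intro height_shift_left zeq) auto
  have right: "height z' k = height z k + c2" if "k \<ge> N + 1" for k
    unfolding c2_def using that by (intro height_shift_right zeq) auto
  \<comment> \<open>Hence |D| \<le> 4N + 2, and with \<open>j \<ge> 10 * N + 10\<close> the levels
    \<open>-j\<close>, \<open>-j + c2\<close> and \<open>-j + D\<close> lie below every height that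
    either path has on the block. The constant 10 is generous.\<close>
  have bounds: "\<bar>c1\<bar> \<le> 2 * N" "\<bar>c2\<bar> \<le> 2 * N + 2"
    using height_abs_le[of z "- N"] height_abs_le[of z' "- N"]
      height_abs_le[of z "N + 1"] height_abs_le[of z' "N + 1"] N
    by (auto simp: c1_def c2_def)
  define P where "P i \<longleftrightarrow> height z (N + 1 + int i) \<le> - j" for i
  obtain n0 where "n0 \<ge> N + 1" "height z n0 \<le> - j" using rz unfolding recurrent_def by blast
  then have "P (nat (n0 - N - 1))" by (simp add: P_def)
  then have Pi: "P (LEAST i. P i)" and less: "\<And>i. i < (LEAST i. P i) \<Longrightarrow> \<not> P i"
    by (auto intro: LeastI dest: not_less_Least)
  \<comment> \<open>The first passage is at \<open>k + 1\<close>; the letter at \<open>k\<close> is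
    the \<open>Beta\<close> stepping down onto level \<open>-j\<close>.\<close>
  define k where "k = N + int (LEAST i. P i)"
  have above: "- j < height z i" if "N + 1 \<le> i" "i \<le> k" for i
  proof -
    have "nat (i - N - 1) < (LEAST i. P i)" using that unfolding k_def by linarith
    from less[OF this] that show ?thesis by (simp add: P_def)
  qed
  have k1: "height z (k + 1) \<le> - j" using Pi P_def[of "LEAST i. P i"] by (simp add: k_def algebra_simps)
  have "(LEAST i. P i) \<noteq> 0"
  proof
    assume "(LEAST i. P i) = 0"
    then have "height z (N + 1) \<le> - j" using Pi P_def[of 0] by simp
    then show False using height_abs_le[of z "N + 1"] N j by simp
  qed
  then have kN: "N + 1 \<le> k" by (simp add: k_def)
  have zk: "z k = 0" and H: "height z (k + 1) = - j"
    using above[of k] kN k1 height_step[of z k] recurrent_binary[OF rz, of k] by auto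
  have z'k: "z' k = 0" using zk zeq[of k] kN N by auto
  have small: "\<bar>height y i\<bar> \<le> N + 1" if "- N \<le> i" "i \<le> N + 1" for y i
    using height_abs_le[of y i] that by auto
  have "epsilon_index k z = last_visit z (- N) (- j)"
    unfolding epsilon_index_eq H
  proof (rule last_visit_extend)
    fix i assume "- N \<le> i" "i < k"
    then show "- j < height z i" using above[of i] small[of i z] j N by (cases "i \<le> N") auto
  qed (use kN N in auto)
  moreover have "last_visit z 0 t = last_visit z (- N) t" if "t < - N - 1" for t
    by (rule last_visit_extend) (use small[of _ z] that N in force)+
  ultimately have e1: "epsilon_index k z = last_visit z 0 (- j)"
      "last_visit z 0 (- j + D) = last_visit z (- N) (- j + D)"
    using j N bounds by (auto simp: D)
  \<comment> \<open>In \<open>x'\<close> the same letter at \<open>k\<close> descends to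
    \<open>-j + c2\<close>. Left of the block \<open>z'\<close> is \<open>z\<close> raised by
    \<open>c1\<close>, so its partner is found in \<open>z\<close> at level
    \<open>-j + c2 - c1 = -j + D\<close>.\<close>
  have H': "height z' (k + 1) = - j + c2" using right[of "k + 1"] kN H by simp
  have "epsilon_index k z' = last_visit z' (- N) (- j + c2)"
    unfolding epsilon_index_eq H'
  proof (rule last_visit_extend)
    fix i assume i: "- N \<le> i" "i < k"
    show "- j + c2 < height z' i"
    proof (cases "i \<le> N")
      case True
      then show ?thesis using small[of i z'] i j N bounds by auto
    next
      case False
      then show ?thesis using above[of i] right[of i] i by auto
    qed
  qed (use kN N in auto)
  also have "\<dots> = last_visit z (- N) (- j + D)"
    by (rule last_visit_cong) (auto simp: left D)
  finally have e2: "epsilon_index k z' = last_visit z 0 (- j + D)" using e1 by simp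
  have "- j + D < height z (- N)" using small[of "- N" z] j N bounds by (auto simp: D)
  from last_visit(1)[OF rz this] have "last_visit z 0 (- j + D) < - N" using e1 by simp
  then have "label x' (last_visit z 0 (- j + D)) = label x (last_visit z 0 (- j + D))"
    using eq[of "last_visit z 0 (- j + D)"] N by (simp add: label_def)
  moreover have "label x k = label x' k" using eq[of k] kN N by (simp add: label_def)
  ultimately show ?thesis
    using label_epsilon_index[OF x, of k] label_epsilon_index[OF x', of k] rz rz' zk z'k e1(1) e2
    by (simp add: z_def z'_def)
qed

text \<open>The height increments over the block differ by twice the difference of the numbers of
  ones, so the displacement \<open>D\<close> is nonzero, and \<open>label_shift\<close> can be
  iterated along levels spaced by |D|, read in one direction or the other according to the sign of
  \<open>D\<close>. The conclusion no longer mentions \<open>x'\<close> and has natural parameters,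
  so the exceptional points form a countable union.\<close>

lemma label_chain:
  fixes N :: int
  assumes "x \<in> dyck_shift m" "x' \<in> dyck_shift m" "recurrent (skeleton x)" "N \<ge> 0"
    and "\<And>k. \<bar>k\<bar> > N \<Longrightarrow> x k = x' k"
    and ne: "(\<Sum>k\<in>{- N..N}. int (skeleton x k)) \<noteq> (\<Sum>k\<in>{- N..N}. int (skeleton x' k))"
  shows "\<exists>j d c. j > 0 \<and> d > 0 \<and>
    (\<forall>t. label x (last_visit (skeleton x) 0 (- int (j + t * d))) = c)"
proof -
  define D where "D = (height (skeleton x') (N + 1) - height (skeleton x') (- N))
    - (height (skeleton x) (N + 1) - height (skeleton x) (- N))"
  have "{- N..<N + 1} = {- N..N}" by auto
  then have "D \<noteq> 0"
    using ne height_eq_sum[OF skeleton_binary, of "- N" "N + 1" x]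
      height_eq_sum[OF skeleton_binary, of "- N" "N + 1" x'] assms(4)
    by (simp add: D_def)
  define g where "g j = label x (last_visit (skeleton x) 0 (- j))" for j
  have g: "g j = g (j - D)" if "j \<ge> 10 * N + 10" for j
    using label_shift[OF assms(1-5) that] by (simp add: g_def D_def)
  define B where "B = 10 * N + 10"
  have "g (B + int t * \<bar>D\<bar>) = g B" for t
  proof (induction t)
    case (Suc t)
    have "B + int t * \<bar>D\<bar> \<ge> 10 * N + 10" "B + int (Suc t) * \<bar>D\<bar> \<ge> 10 * N + 10"
      by (auto simp: B_def)
    from g[OF this(1)] g[OF this(2)] Suc show ?case
      by (cases "D \<ge> 0") (simp_all add: algebra_simps)
  qed simp
  then show ?thesis
    using \<open>D \<noteq> 0\<close> assms(4)
    by (intro exI[of _ "nat B"] exI[of _ "nat \<bar>D\<bar>"] exI[of _ "g B"])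
      (auto simp: g_def B_def)
qed

text \<open>Any \<open>n\<close> of these distinct coordinates are independent, and each equals
  \<open>c\<close> with probability at most 1/m \<le> 1/2; this is where \<open>m \<ge> 2\<close> is
  used.\<close>

lemma emeasure_mu2_constant_along:
  fixes r :: "nat \<Rightarrow> int"
  assumes m: "m \<ge> 2" and r: "inj r"
  shows "emeasure (mu2 m) {b \<in> space (mu2 m). \<forall>t. b (r t) = c} = 0"
proof -
  let ?M = "uniform_count_measure {1..m}"
  interpret M: prob_space ?M using m by (intro prob_space_uniform_count_measure) auto
  interpret product_prob_space "\<lambda>_. ?M" "UNIV :: int set" ..
  let ?E = "{b \<in> space (mu2 m). \<forall>t. b (r t) = c}"
  have le: "emeasure (mu2 m) ?E \<le> ennreal ((1 / 2) ^ n)" for n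
  proof -
    \<comment> \<open>The intersection covers a \<open>c\<close> that is not a label;
      \<open>?A\<close> is then empty.\<close>
    let ?A = "{c} \<inter> {1..m}"
    have "emeasure (mu2 m) ?E \<le> emeasure (mu2 m) {b \<in> space (mu2 m). \<forall>i\<in>r ` {..<n}. b i \<in> ?A}"
    proof (rule emeasure_mono)
      have [measurable]: "Measurable.pred (mu2 m) (\<lambda>b. b i \<in> ?A)" for i
        by (rule measurable_compose[OF measurable_mu2_component]) simp
      show "{b \<in> space (mu2 m). \<forall>i\<in>r ` {..<n}. b i \<in> ?A} \<in> sets (mu2 m)"
        by measurable
    qed (fastforce simp: space_mu2 Pi_iff)
    also have "\<dots> = (\<Prod>i\<in>r ` {..<n}. emeasure ?M ?A)"
      unfolding mu2_def by (rule emeasure_PiM_Collect) (auto simp: sets_uniform_count_measure)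
    also have "\<dots> = emeasure ?M ?A ^ n"
      using r by (simp add: card_image inj_on_subset)
    also have "\<dots> \<le> ennreal (1 / 2) ^ n"
    proof (rule power_mono)
      have "card ?A \<le> 1" using card_mono[of "{c}" ?A] by simp
      then have le: "real (card ?A) / real m \<le> 1 / 2" using m by (simp add: field_simps)
      have "emeasure ?M ?A = ennreal (real (card ?A) / real m)"
        by (subst emeasure_uniform_count_measure) auto
      also have "\<dots> \<le> ennreal (1 / 2)" using le by (rule ennreal_leI)
      finally show "emeasure ?M ?A \<le> ennreal (1 / 2)" .
    qed simp
    also have "\<dots> = ennreal ((1 / 2) ^ n)" by (rule ennreal_power) simp
    finally show ?thesis .
  qed
  have "(\<lambda>n. ennreal ((1 / 2) ^ n)) \<longlonglongrightarrow> ennreal 0"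
    by (intro tendsto_ennrealI LIMSEQ_realpow_zero) auto
  then have "emeasure (mu2 m) ?E \<le> ennreal 0"
    by (rule LIMSEQ_le_const) (use le in blast)
  then show ?thesis by simp
qed

text \<open>The positions depend on \<open>z\<close> alone and are distinct, lying at distinct
  heights, so for fixed \<open>z\<close>, \<open>j\<close>, \<open>d\<close>, \<open>c\<close> the
  event is null. Since \<open>j > 0\<close>, all levels are below the height 0 of the origin, so the
  last visits exist.\<close>

lemma AE_no_constant_chain:
  assumes m: "m \<ge> 2"
  shows "AE p in mu1 \<Otimes>\<^sub>M mu2 m. recurrent (fst p) \<longrightarrow>
    \<not> (\<exists>j d c. j > 0 \<and> d > 0 \<and> (\<forall>t. snd p (last_visit (fst p) 0 (- int (j + t * d))) = c))"
proof -
  interpret mu1: prob_space mu1 by (rule prob_space_mu1)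
  interpret mu2: prob_space "mu2 m" using m by (intro prob_space_mu2) auto
  interpret P: pair_prob_space mu1 "mu2 m" ..
  have *: "AE p in mu1 \<Otimes>\<^sub>M mu2 m. recurrent (fst p) \<longrightarrow>
      \<not> (\<forall>t. snd p (last_visit (fst p) 0 (- int (j + t * d))) = c)"
    if jd: "j > 0" "d > 0" for j d c :: nat
  proof (rule P.AE_pair_measure)
    have [measurable]: "(\<lambda>p. snd p (last_visit (fst p) 0 t)) \<in> mu1 \<Otimes>\<^sub>M mu2 m \<rightarrow>\<^sub>M count_space UNIV" for t
      by (rule measurable_pair_mu2) measurable
    show "{p \<in> space (mu1 \<Otimes>\<^sub>M mu2 m). recurrent (fst p) \<longrightarrow>
      \<not> (\<forall>t. snd p (last_visit (fst p) 0 (- int (j + t * d))) = c)} \<in> sets (mu1 \<Otimes>\<^sub>M mu2 m)"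
      by measurable
    show "AE z in mu1. AE b in mu2 m. recurrent (fst (z, b)) \<longrightarrow>
      \<not> (\<forall>t. snd (z, b) (last_visit (fst (z, b)) 0 (- int (j + t * d))) = c)"
    proof (rule AE_I2)
      fix z
      show "AE b in mu2 m. recurrent (fst (z, b)) \<longrightarrow>
        \<not> (\<forall>t. snd (z, b) (last_visit (fst (z, b)) 0 (- int (j + t * d))) = c)"
      proof (cases "recurrent z")
        case True
        have "inj (\<lambda>t. last_visit z 0 (- int (j + t * d)))"
        proof (rule injI)
          fix s t assume "last_visit z 0 (- int (j + s * d)) = last_visit z 0 (- int (j + t * d))"
          moreover have "height z (last_visit z 0 (- int (j + t * d))) = - int (j + t * d)" for t
            using jd by (intro last_visit(2)[OF True]) (simp del: of_nat_add of_nat_mult)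
          ultimately have "- int (j + s * d) = - int (j + t * d)" by metis
          then show "s = t" using jd by simp
        qed
        from emeasure_mu2_constant_along[OF m this, of c] show ?thesis
          by (intro AE_I[where N = "{b \<in> space (mu2 m). \<forall>t. b (last_visit z 0 (- int (j + t * d))) = c}"])
            auto
      qed simp
    qed
  qed
  have "AE p in mu1 \<Otimes>\<^sub>M mu2 m. j > 0 \<longrightarrow> d > 0 \<longrightarrow> recurrent (fst p) \<longrightarrow>
      \<not> (\<forall>t. snd p (last_visit (fst p) 0 (- int (j + t * d))) = c)" for j d c
    using *[of j d c] by (cases "j > 0 \<and> d > 0") auto
  then have "AE p in mu1 \<Otimes>\<^sub>M mu2 m. \<forall>j d c. j > 0 \<longrightarrow> d > 0 \<longrightarrow> recurrent (fst p) \<longrightarrow>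
      \<not> (\<forall>t. snd p (last_visit (fst p) 0 (- int (j + t * d))) = c)"
    unfolding AE_all_countable by blast
  then show ?thesis by eventually_elim blast
qed

text \<open>On a cylinder, a constraint on coordinate \<open>i\<close> of the image is a constraint
  on coordinate \<open>\<pi> i\<close> of the argument, allowing equally many values because
  \<open>f i\<close> is a bijection; injectivity of \<open>\<pi>\<close> keeps these coordinates
  distinct.\<close>

lemma distr_PiM_uniform:
  fixes \<pi> :: "'i \<Rightarrow> 'i" and f :: "'i \<Rightarrow> 'a \<Rightarrow> 'a"
  assumes S: "finite S" "S \<noteq> {}" and \<pi>: "inj \<pi>" and f: "\<And>i. bij_betw (f i) S S"
  defines "P \<equiv> PiM UNIV (\<lambda>_. uniform_count_measure S)"
  shows "(\<lambda>w i. f i (w (\<pi> i))) \<in> P \<rightarrow>\<^sub>M P" (is "?F \<in> _")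
    and "distr P P (\<lambda>w i. f i (w (\<pi> i))) = P"
proof -
  let ?M = "uniform_count_measure S"
  interpret M: prob_space ?M using S by (intro prob_space_uniform_count_measure)
  interpret product_prob_space "\<lambda>_. ?M" "UNIV :: 'i set" ..
  have fS: "f i s \<in> S" if "s \<in> S" for i s using f[of i] that by (auto dest: bij_betwE)
  show F: "?F \<in> P \<rightarrow>\<^sub>M P"
    unfolding P_def
  proof (rule measurable_PiM_single')
    fix i
    have "f i \<in> ?M \<rightarrow>\<^sub>M ?M"
      using fS by (intro measurableI) (auto simp: space_uniform_count_measure sets_uniform_count_measure)
    then show "(\<lambda>w. f i (w (\<pi> i))) \<in> PiM UNIV (\<lambda>_. ?M) \<rightarrow>\<^sub>M ?M"
      by (rule measurable_compose[rotated]) simp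
  qed (use fS in \<open>auto simp: space_PiM space_uniform_count_measure PiE_UNIV_domain\<close>)
  have "P = distr P P ?F"
  proof (rule measure_eqI_PiM_infinite[where M = "\<lambda>_. ?M" and I = UNIV])
    fix A and J :: "'i set"
    assume J: "finite J" and A: "\<And>i. i \<in> J \<Longrightarrow> A i \<in> sets ?M"
    define X where "X k = {s \<in> S. f (inv \<pi> k) s \<in> A (inv \<pi> k)}" for k
    let ?E = "prod_emb UNIV (\<lambda>_. ?M) J (Pi\<^sub>E J A)"
    have AS: "A i \<subseteq> S" if "i \<in> J" for i using A[OF that] by (simp add: sets_uniform_count_measure)
    have card: "card {s \<in> S. f i s \<in> A i} = card (A i)" if "i \<in> J" for i
    proof -
      have "bij_betw (f i) {s \<in> S. f i s \<in> A i} (A i)"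
        using f[of i] AS[OF that] by (fastforce simp: bij_betw_def inj_on_def)
      then show ?thesis by (rule bij_betw_same_card)
    qed
    have E: "?E \<in> sets P" unfolding P_def using J A by (intro sets_PiM_I) auto
    have "emeasure (distr P P ?F) ?E = emeasure P (?F -` ?E \<inter> space P)"
      by (rule emeasure_distr[OF F E])
    also have "?F -` ?E \<inter> space P = {w \<in> space P. \<forall>k\<in>\<pi> ` J. w k \<in> X k}"
      using \<pi> fS
      by (auto simp: prod_emb_def P_def space_PiM space_uniform_count_measure PiE_UNIV_domain X_def
          PiE_iff Pi_iff)
    also have "emeasure P \<dots> = (\<Prod>k\<in>\<pi> ` J. emeasure ?M (X k))"
      unfolding P_def using J
      by (intro emeasure_PiM_Collect) (auto simp: X_def sets_uniform_count_measure)
    also have "\<dots> = (\<Prod>i\<in>J. emeasure ?M (A i))"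
    proof (subst prod.reindex)
      show "inj_on \<pi> J" using \<pi> by (rule inj_on_subset) simp
      show "prod ((\<lambda>k. emeasure ?M (X k)) \<circ> \<pi>) J = (\<Prod>i\<in>J. emeasure ?M (A i))"
        using AS card \<pi> S(1)
        by (intro prod.cong) (auto simp: X_def emeasure_uniform_count_measure)
    qed
    also have "\<dots> = emeasure P ?E"
      unfolding P_def by (rule emeasure_PiM_emb[symmetric]) (use J A in auto)
    finally show "emeasure P ?E = emeasure (distr P P ?F) ?E" by simp
  next
    show "finite_measure P" unfolding P_def by (rule P.finite_measure_axioms)
  qed (simp_all add: P_def)
  then show "distr P P ?F = P" by simp
qed

text \<open>Glues bijections from \<open>A\<close> to \<open>B\<close> and from \<open>J - A\<close>
  to \<open>J - B\<close> with the identity outside \<open>J\<close>. It serves to fetch the label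
  of each one of a new block from a one of the old block.\<close>

lemma exists_block_permutation:
  assumes J: "finite J" "A \<subseteq> J" "B \<subseteq> J" and card: "card A = card B"
  obtains \<pi> where "inj \<pi>" "\<And>i. i \<notin> J \<Longrightarrow> \<pi> i = i" "\<And>i. i \<in> A \<Longrightarrow> \<pi> i \<in> B"
proof -
  have fin: "finite A" "finite B" using J finite_subset by auto
  then obtain h where h: "bij_betw h A B" using card by (metis finite_same_card_bij)
  have "card (J - A) = card (J - B)" using J fin card by (simp add: card_Diff_subset)
  then obtain h' where h': "bij_betw h' (J - A) (J - B)"
    using J by (metis finite_Diff finite_same_card_bij)
  define \<pi> where "\<pi> i = (if i \<in> A then h i else if i \<in> J then h' i else i)" for i
  have \<pi>_in: "\<pi> i \<in> B" "\<pi> i = h i" if "i \<in> A" for i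
    using h that by (auto simp: \<pi>_def dest: bij_betwE)
  have \<pi>_diff: "\<pi> i \<in> J - B" "\<pi> i = h' i" if "i \<in> J - A" for i
    using bij_betwE[OF h'] that by (auto simp: \<pi>_def)
  have \<pi>_out: "\<pi> i = i" if "i \<notin> J" for i using that J by (auto simp: \<pi>_def)
  have "inj \<pi>"
  proof (rule injI)
    fix i j assume eq: "\<pi> i = \<pi> j"
    consider "i \<in> A" | "i \<in> J - A" | "i \<notin> J" by blast
    then show "i = j"
    proof cases
      case 1
      then have "j \<in> A" using \<pi>_in \<pi>_diff \<pi>_out eq J by (metis Diff_iff subsetD)
      with 1 eq h show ?thesis by (auto simp: \<pi>_in bij_betw_def dest: inj_onD)
    next
      case 2
      then have "j \<in> J - A" using \<pi>_in \<pi>_diff \<pi>_out eq J by (metis Diff_iff subsetD)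
      with 2 eq h' show ?thesis by (auto simp: \<pi>_diff bij_betw_def dest: inj_onD)
    next
      case 3
      then have "j \<notin> J" using \<pi>_in \<pi>_diff \<pi>_out eq J by (metis Diff_iff subsetD)
      with 3 eq show ?thesis by (simp add: \<pi>_out)
    qed
  qed
  then show ?thesis using \<pi>_out \<pi>_in(1) by (rule that)
qed

section \<open>Effect of one block replacement on the measure\<close>

lemma skeleton_label_override_on [simp]:
  "a \<in> J \<Longrightarrow> skeleton (override_on x v J) a = skeleton v a"
  "a \<notin> J \<Longrightarrow> skeleton (override_on x v J) a = skeleton x a"
  "a \<in> J \<Longrightarrow> label (override_on x v J) a = label v a"
  "a \<notin> J \<Longrightarrow> label (override_on x v J) a = label x a"
  by (simp_all add: skeleton_def label_def)

text \<open>With as many \<open>Alpha\<close>s in \<open>v\<close> as in \<open>u\<close>, replacing the block \<open>u\<close> by \<open>v\<close> is the effect of a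
  measure preserving map on skeletons and labels. Otherwise the right half of the point would be
  matched with two distinct shifts of the left half, which has probability zero.\<close>

lemma emeasure_mu_tilde_override_le:
  fixes N :: nat and u v :: "int \<Rightarrow> letter"
  defines "J \<equiv> {- int N..int N}"
  assumes m: "m \<ge> 2" and C: "C \<in> sets (dyck_borel m)" and C': "C' \<in> sets (dyck_borel m)"
    and u: "\<And>x k. x \<in> C \<Longrightarrow> k \<in> J \<Longrightarrow> x k = u k"
    and v: "\<And>x. x \<in> C \<Longrightarrow> override_on x v J \<in> C'"
  shows "emeasure (mu_tilde m) C \<le> emeasure (mu_tilde m) C'"
proof -
  let ?P = "mu1 \<Otimes>\<^sub>M mu2 m"
  have CX: "C \<subseteq> dyck_shift m" "C' \<subseteq> dyck_shift m"
    using sets.sets_into_space[OF C] sets.sets_into_space[OF C'] by (auto simp: space_dyck_borel)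
  have m1: "m \<ge> 1" using m by simp
  define E where "E D = {p \<in> space ?P. recurrent (fst p) \<and> code p \<in> D}" for D
  have E: "E D \<in> sets ?P" if "D \<in> sets (dyck_borel m)" for D
    unfolding E_def using that by measurable
  have E_eq: "emeasure (mu_tilde m) D = emeasure ?P (E D)" if "D \<in> sets (dyck_borel m)" for D
    unfolding E_def by (rule emeasure_mu_tilde[OF m1 that])
  have skel: "skeleton (code p) = fst p" "label (code p) i = snd p i"
    if "recurrent (fst p)" "fst p i = 1" for p i
    using that skeleton_code[of "fst p" "snd p"] by (auto simp: recurrent_def code_def label_def case_prod_unfold)
  define Au Av where "Au = {i \<in> J. skeleton u i = 1}" and "Av = {i \<in> J. skeleton v i = 1}"
  have fin: "finite J" by (simp add: J_def)
  \<comment> \<open>The empty \<open>C\<close> goes with the null case, so that the other case has a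
    point \<open>x0\<close>, which shows that \<open>u\<close> and \<open>v\<close> take letters of
    the alphabet on \<open>J\<close>.\<close>
  show ?thesis
  proof (cases "C = {} \<or> card Au \<noteq> card Av")
    case True
    have "AE p in ?P. \<not> (recurrent (fst p) \<and> code p \<in> C)"
      using AE_no_constant_chain[OF m]
    proof eventually_elim
      case (elim p)
      show ?case
      proof
        assume p: "recurrent (fst p) \<and> code p \<in> C"
        define x where "x = code p"
        have x: "x \<in> C" and rx: "recurrent (fst p)" and sk: "skeleton x = fst p"
          using p skeleton_code[of "fst p" "snd p"] by (auto simp: x_def recurrent_def)
        define x' where "x' = override_on x v J"
        have sum_card: "(\<Sum>k\<in>J. int (skeleton y k)) = int (card {i \<in> J. skeleton y i = 1})" for y
        proof -
          have "int (skeleton y k) = of_bool (skeleton y k = 1)" for k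
            using skeleton_binary[of y] by (auto simp: skeleton_def split: letter.splits)
          then show ?thesis using fin by (simp add: Int_def)
        qed
        have "{i \<in> J. skeleton x i = 1} = Au" "{i \<in> J. skeleton x' i = 1} = Av"
          using u[OF x] by (auto simp: Au_def Av_def x'_def skeleton_def)
        then have ne: "(\<Sum>k\<in>J. int (skeleton x k)) \<noteq> (\<Sum>k\<in>J. int (skeleton x' k))"
          using True x unfolding sum_card by auto
        have "\<exists>j d c. j > 0 \<and> d > 0 \<and>
            (\<forall>t. label x (last_visit (skeleton x) 0 (- int (j + t * d))) = c)"
        proof (rule label_chain[where N = "int N"])
          show "x \<in> dyck_shift m" "x' \<in> dyck_shift m" using x v CX by (auto simp: x'_def)
          show "x k = x' k" if "int N < \<bar>k\<bar>" for k using that by (auto simp: x'_def J_def override_on_def)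
        qed (use rx sk ne in \<open>auto simp: J_def\<close>)
        then obtain j d c where jd: "j > 0" "d > 0"
          and c: "\<And>t. label x (last_visit (skeleton x) 0 (- int (j + t * d))) = c" by blast
        have "snd p (last_visit (fst p) 0 (- int (j + t * d))) = c" for t
        proof -
          have "fst p (last_visit (fst p) 0 (- int (j + t * d))) = 1"
            using jd by (intro last_visit(3)[OF rx]) (simp del: of_nat_add of_nat_mult)
          from skel(2)[OF rx this, folded x_def] c[of t, unfolded sk] show ?thesis by metis
        qed
        with elim rx jd show False by blast
      qed
    qed
    then have "emeasure ?P (E C) = 0"
      using AE_iff_measurable[OF E[OF C], of "\<lambda>p. \<not> (recurrent (fst p) \<and> code p \<in> C)"]
      by (simp add: E_def)
    then show ?thesis using E_eq[OF C] by simp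
  next
    case False
    then have card: "card Av = card Au" by simp
    obtain x0 where x0: "x0 \<in> C" using False by auto
    have alph: "u k \<in> dyck_alphabet m" "v k \<in> dyck_alphabet m" if "k \<in> J" for k
    proof -
      have "x0 \<in> dyck_shift m" "override_on x0 v J \<in> dyck_shift m" using x0 v CX by auto
      then have "x0 k \<in> dyck_alphabet m" "override_on x0 v J k \<in> dyck_alphabet m"
        by (auto simp: dyck_shift_def)
      then show "u k \<in> dyck_alphabet m" "v k \<in> dyck_alphabet m" using u[OF x0 that] that by auto
    qed
    obtain \<pi> where \<pi>: "inj \<pi>" "\<And>i. i \<notin> J \<Longrightarrow> \<pi> i = i" "\<And>i. i \<in> Av \<Longrightarrow> \<pi> i \<in> Au"
      by (rule exists_block_permutation[OF fin _ _ card]) (auto simp: Au_def Av_def)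
    \<comment> \<open>Writing the values of \<open>v\<close> directly would not preserve the
      measure. A transposition does, and it has the same effect on points whose block is
      \<open>u\<close>.\<close>
    define tz where "tz i = (if i \<in> J then Transposition.transpose (skeleton u i) (skeleton v i) else id)" for i
    \<comment> \<open>For \<open>i\<close> in \<open>Av\<close>, the label fetched from the one
      \<open>\<pi> i\<close> of \<open>u\<close> is \<open>label u (\<pi> i)\<close>, which the
      transposition turns into \<open>label v i\<close>.\<close>
    define tb where "tb i = (if i \<in> Av then Transposition.transpose (label u (\<pi> i)) (label v i) else id)" for i
    define Fz where "Fz = (\<lambda>z i. tz i (z i))"
    define Fb where "Fb = (\<lambda>b i. tb i (b (\<pi> i)))"
    have tz: "bij_betw (tz i) {0, 1} {0, 1}" for i
    proof -
      have "skeleton u i \<in> {0, 1} \<longleftrightarrow> skeleton v i \<in> {0, 1}"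
        using skeleton_binary[of u] skeleton_binary[of v] by blast
      from bij_betw_transpose_iff[OF this] show ?thesis by (simp add: tz_def)
    qed
    have tb: "bij_betw (tb i) {1..m} {1..m}" for i
    proof (cases "i \<in> Av")
      case True
      then have "\<pi> i \<in> J" "i \<in> J" using \<pi>(3)[OF True] by (auto simp: Au_def Av_def)
      then have "label u (\<pi> i) \<in> {1..m}" "label v i \<in> {1..m}"
        by (auto simp only: alph intro!: label_range)
      then show ?thesis using True by (simp add: tb_def)
    qed (simp add: tb_def)
    have z: "Fz \<in> mu1 \<rightarrow>\<^sub>M mu1" "distr mu1 mu1 Fz = mu1"
      using distr_PiM_uniform[of "{0, 1}" "\<lambda>i. i" tz] tz by (auto simp: mu1_def Fz_def)
    have b: "Fb \<in> mu2 m \<rightarrow>\<^sub>M mu2 m" "distr (mu2 m) (mu2 m) Fb = mu2 m"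
      using distr_PiM_uniform[of "{1..m}" \<pi> tb] tb \<pi>(1) m1 by (auto simp: mu2_def Fb_def)
    let ?F = "\<lambda>(z, b). (Fz z, Fb b)"
    interpret mu2: prob_space "mu2 m" using m1 by (rule prob_space_mu2)
    have F: "?F \<in> ?P \<rightarrow>\<^sub>M ?P" using z(1) b(1) by measurable
    have FP: "distr ?P ?P ?F = ?P"
      using pair_measure_distr[OF z(1) b(1)] b(2) z(2) mu2.sigma_finite_measure_axioms by simp
    have "?F p \<in> E C'" if "p \<in> E C" for p
    proof -
      obtain z b where p: "p = (z, b)" by (cases p)
      have pP: "p \<in> space ?P" and rz: "recurrent z" and x: "code (z, b) \<in> C"
        using that by (auto simp: E_def p)
      define x where "x = code (z, b)"
      define x' where "x' = override_on x v J"
      have xC: "x \<in> C" using x by (simp add: x_def)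
      have sk: "skeleton x = z" using rz by (simp add: x_def skeleton_code recurrent_def)
      have lab: "label x i = b i" if "z i = 1" for i using that by (simp add: x_def code_def label_def)
      have xu: "skeleton x i = skeleton u i" "label x i = label u i" if "i \<in> J" for i
        using u[OF xC that] by (auto simp: skeleton_def label_def)
      have x'C: "x' \<in> C'" using v xC by (simp add: x'_def)
      have sk': "skeleton x' = Fz z"
      proof
        fix i
        show "skeleton x' i = Fz z i"
          using xu(1)[of i] by (cases "i \<in> J") (simp_all add: x'_def Fz_def tz_def sk[symmetric])
      qed
      have rx': "recurrent (skeleton x')"
      proof (rule recurrent_finite_change[OF rz skeleton_binary, where N = "int N"])
        show "z k = skeleton x' k" if "int N < \<bar>k\<bar>" for k
        proof -
          have "k \<notin> J" using that by (auto simp: J_def)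
          then show ?thesis by (simp add: x'_def sk)
        qed
      qed
      \<comment> \<open>As \<open>x'\<close> lies in the shift, the labels of its
        \<open>Beta\<close>s are forced, and only those at its ones remain to be compared with
        \<open>Fb b\<close>.\<close>
      have "x' = code (skeleton x', label x')"
        using x'C CX rx' by (intro code_skeleton_label[symmetric]) auto
      also have "\<dots> = code (skeleton x', Fb b)"
      proof (rule code_cong[OF rx'])
        fix i assume i: "skeleton x' i = 1"
        show "label x' i = Fb b i"
        proof (cases "i \<in> J")
          case True
          then have Av: "i \<in> Av" using i by (simp add: x'_def Av_def)
          then have pi: "\<pi> i \<in> Au" by (rule \<pi>(3))
          then have "b (\<pi> i) = label u (\<pi> i)"
            using xu[of "\<pi> i"] lab[of "\<pi> i"] sk by (simp add: Au_def)
          then show ?thesis using True Av by (simp add: x'_def Fb_def tb_def)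
        next
          case False
          then have "i \<notin> Av" by (simp add: Av_def)
          with False show ?thesis
            using i lab[of i] sk \<pi>(2) by (simp add: x'_def Fb_def tb_def)
        qed
      qed
      finally have "x' = code (Fz z, Fb b)" by (simp add: sk')
      moreover have "recurrent (Fz z)" using rx' by (simp only: sk')
      ultimately show ?thesis using measurable_space[OF F pP] x'C by (simp add: E_def p)
    qed
    \<comment> \<open>An inclusion is enough: the reverse inequality comes from exchanging the roles
      of \<open>u\<close> and \<open>v\<close>.\<close>
    then have sub: "E C \<subseteq> ?F -` E C' \<inter> space ?P" by (auto simp: E_def)
    have "emeasure ?P (E C) \<le> emeasure ?P (?F -` E C' \<inter> space ?P)"
      by (rule emeasure_mono[OF sub measurable_sets[OF F E[OF C']]])
    also have "\<dots> = emeasure (distr ?P ?P ?F) (E C')"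
      by (rule emeasure_distr[OF F E[OF C'], symmetric])
    finally show ?thesis unfolding FP E_eq[OF C] E_eq[OF C'] .
  qed
qed

section \<open>Exact invariance under block replacements and the decomposition of a holonomy\<close>

instance letter :: countable by countable_datatype

lemma measurable_map_window:
  fixes f :: "'a \<Rightarrow> int \<Rightarrow> letter"
  assumes "\<And>i. (\<lambda>x. f x i) \<in> M \<rightarrow>\<^sub>M count_space UNIV"
  shows "(\<lambda>x. map (f x) ks) \<in> M \<rightarrow>\<^sub>M count_space UNIV"
proof (induction ks)
  case (Cons i ks)
  from measurable_countable_op[OF assms[of i] Cons, of Cons] show ?case by simp
qed simp

text \<open>Lets a set of \<open>dyck_borel m\<close> be regarded as a set of the full product,
  where a point lands if putting a block into it leaves the shift.\<close>

lemma sets_dyck_shift: "dyck_shift m \<in> sets (PiM UNIV (\<lambda>_. count_space (dyck_alphabet m)))"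
proof -
  let ?P = "PiM UNIV (\<lambda>_::int. count_space (dyck_alphabet m))"
  have "Measurable.pred ?P (\<lambda>x. map x [r..l] \<in> dyck_language m)" for r l :: int
    by (rule measurable_compose[OF measurable_map_window])
      (auto intro: measurable_PiM_count_space_component[OF HOL.refl])
  then have "{x \<in> space ?P. \<forall>r l. r \<le> l \<longrightarrow> map x [r..l] \<in> dyck_language m} \<in> sets ?P"
    by measurable
  also have "{x \<in> space ?P. \<forall>r l. r \<le> l \<longrightarrow> map x [r..l] \<in> dyck_language m} = dyck_shift m"
    by (auto simp: dyck_shift_def space_PiM PiE_UNIV_domain)
  finally show ?thesis .
qed

text \<open>Restoring \<open>u\<close> inverts the replacement on \<open>C\<close>. This gives the
  reverse inequality, and it describes the image as the points with block \<open>v\<close> whose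
  restoration lies in \<open>C\<close>, which makes it measurable.\<close>

lemma emeasure_mu_tilde_override:
  fixes N :: nat and u v :: "int \<Rightarrow> letter"
  defines "J \<equiv> {- int N..int N}"
  assumes m: "m \<ge> 2" and C: "C \<in> sets (dyck_borel m)"
    and u: "\<And>x k. x \<in> C \<Longrightarrow> k \<in> J \<Longrightarrow> x k = u k"
    and v: "\<And>x. x \<in> C \<Longrightarrow> override_on x v J \<in> dyck_shift m"
  defines "C' \<equiv> (\<lambda>x. override_on x v J) ` C"
  shows "C' \<in> sets (dyck_borel m)" "emeasure (mu_tilde m) C = emeasure (mu_tilde m) C'"
proof -
  let ?P = "PiM UNIV (\<lambda>_::int. count_space (dyck_alphabet m))"
  have CX: "C \<subseteq> dyck_shift m" using sets.sets_into_space[OF C] by (simp add: space_dyck_borel)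
  have restore: "override_on (override_on x v J) u J = x" if "x \<in> C" for x
    using u[OF that] by (auto simp: override_on_def)
  show C': "C' \<in> sets (dyck_borel m)"
  proof (cases "C = {}")
    case False
    then obtain x0 where x0: "x0 \<in> C" by blast
    with CX have "x0 \<in> dyck_shift m" by blast
    then have "x0 k \<in> dyck_alphabet m" for k by (auto simp: dyck_shift_def)
    then have ualph: "u k \<in> dyck_alphabet m" if "k \<in> J" for k using u[OF x0 that] by metis
    have "C \<in> sets ?P"
      using C sets_dyck_shift[of m] unfolding dyck_borel_def by (simp add: sets_restrict_space_iff)
    moreover have "(\<lambda>y. override_on y u J) \<in> dyck_borel m \<rightarrow>\<^sub>M ?P"
    proof (rule measurable_PiM_single')
      fix i
      show "(\<lambda>y. override_on y u J i) \<in> dyck_borel m \<rightarrow>\<^sub>M count_space (dyck_alphabet m)"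
      proof (rule measurable_count_space_subset)
        show "(\<lambda>y. override_on y u J i) \<in> dyck_borel m \<rightarrow>\<^sub>M count_space UNIV"
          by (cases "i \<in> J") simp_all
      qed (use ualph in \<open>auto simp: override_on_def space_dyck_borel dyck_shift_def\<close>)
    qed (use ualph in \<open>auto simp: override_on_def space_dyck_borel dyck_shift_def PiE_UNIV_domain\<close>)
    ultimately have "{y \<in> space (dyck_borel m). override_on y u J \<in> C} \<in> sets (dyck_borel m)"
      by (auto dest: measurable_sets simp: vimage_def Int_def conj_commute)
    moreover have "{y \<in> space (dyck_borel m). \<forall>k\<in>J. y k = v k} \<in> sets (dyck_borel m)"
      by measurable
    ultimately have "{y \<in> space (dyck_borel m). override_on y u J \<in> C} \<inter>
      {y \<in> space (dyck_borel m). \<forall>k\<in>J. y k = v k} \<in> sets (dyck_borel m)" by (rule sets.Int)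
    moreover have "{y \<in> space (dyck_borel m). override_on y u J \<in> C} \<inter>
      {y \<in> space (dyck_borel m). \<forall>k\<in>J. y k = v k} = C'"
    proof safe
      fix y assume y: "override_on y u J \<in> C" "\<forall>k\<in>J. y k = v k"
      then have "y = override_on (override_on y u J) v J" by (auto simp: override_on_def)
      then show "y \<in> C'" using y unfolding C'_def by blast
    next
      fix y assume "y \<in> C'"
      then obtain x where x: "x \<in> C" "y = override_on x v J" by (auto simp: C'_def)
      then show "y \<in> space (dyck_borel m)" "y \<in> space (dyck_borel m)" "override_on y u J \<in> C"
        using v restore by (auto simp: space_dyck_borel)
      show "y k = v k" if "k \<in> J" for k using that x by simp
    qed
    ultimately show ?thesis by simp
  qed (simp add: C'_def)
  show "emeasure (mu_tilde m) C = emeasure (mu_tilde m) C'"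
  proof (rule antisym)
    show "emeasure (mu_tilde m) C \<le> emeasure (mu_tilde m) C'"
      by (rule emeasure_mu_tilde_override_le[OF m C C', of N u v])
        (use u in \<open>auto simp: J_def C'_def\<close>)
    show "emeasure (mu_tilde m) C' \<le> emeasure (mu_tilde m) C"
      by (rule emeasure_mu_tilde_override_le[OF m C' C, of N v u])
        (use restore in \<open>auto simp: J_def C'_def\<close>)
  qed
qed

lemma sets_mu_tilde [measurable_cong]: "sets (mu_tilde m) = sets (dyck_borel m)"
  by (simp add: mu_tilde_def)

lemma double_tail_invariant_mu_tilde:
  assumes m: "m \<ge> 2"
  shows "double_tail_invariant m (mu_tilde m)"
  unfolding double_tail_invariant_def
proof (intro allI impI)
  fix A g
  assume "holonomy m A g"
  then have A: "A \<in> sets (dyck_borel m)" and inj: "inj_on g A"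
    and g: "g \<in> restrict_space (dyck_borel m) A \<rightarrow>\<^sub>M dyck_borel m"
    and tail: "\<And>x. x \<in> A \<Longrightarrow> (x, g x) \<in> double_tail m"
    by (auto simp: holonomy_def)
  define agree where "agree n x \<longleftrightarrow> (\<forall>k. \<bar>k\<bar> > int n \<longrightarrow> x k = g x k)" for n x
  define window :: "nat \<Rightarrow> int list" where "window n = [- int n..int n]" for n
  \<comment> \<open>The least \<open>n\<close> makes the pieces disjoint, and finite words in place
    of functions on the integers make the index type countable.\<close>
  define piece where "piece = (\<lambda>(n, u, v). {x \<in> A. (agree n x \<and> (\<forall>n'<n. \<not> agree n' x)) \<and>
    map x (window n) = u \<and> map (g x) (window n) = v})"
  \<comment> \<open>Spreads a word over the window, whose left end \<open>-n\<close> is index 0 of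
    the word; the values outside the window are meaningless and are discarded by
    \<open>override_on\<close>.\<close>
  define block where "block n w k = w ! nat (k + int n)" for n :: nat and w :: "letter list" and k :: int
  have block: "block n (map x (window n)) k = x k" if "k \<in> {- int n..int n}" for n k x
    using that by (auto simp: block_def window_def nth_upto)
  let ?R = "restrict_space (dyck_borel m) A"
  have AX: "A \<subseteq> space (dyck_borel m)" using A by (rule sets.sets_into_space)
  have R: "space ?R = A" using AX by (auto simp: space_restrict_space)
  have comp: "(\<lambda>x. x k) \<in> ?R \<rightarrow>\<^sub>M count_space UNIV" "(\<lambda>x. g x k) \<in> ?R \<rightarrow>\<^sub>M count_space UNIV" for k
    by (rule measurable_restrict_space1[OF measurable_dyck_component],
        rule measurable_compose[OF g measurable_dyck_component])
  have [measurable]: "Measurable.pred ?R (\<lambda>x. x k = g x k)" for k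
    by (rule measurable_countable_op[OF comp])
  have [measurable]: "Measurable.pred ?R (agree n)" for n
    unfolding agree_def by measurable
  have [measurable]: "Measurable.pred ?R (\<lambda>x. map x (window n) = u)"
      "Measurable.pred ?R (\<lambda>x. map (g x) (window n) = u)" for n u
    by (rule measurable_compose[OF measurable_map_window[OF comp(1)]], simp)
      (rule measurable_compose[OF measurable_map_window[OF comp(2)]], simp)
  have piece_sets: "piece p \<in> sets (dyck_borel m)" for p
  proof -
    obtain n u v where p: "p = (n, u, v)" by (cases p)
    have "{x \<in> space ?R. (agree n x \<and> (\<forall>n'<n. \<not> agree n' x)) \<and>
      map x (window n) = u \<and> map (g x) (window n) = v} \<in> sets ?R"
      by measurable
    then show ?thesis using A AX by (simp add: piece_def p R sets_restrict_space_iff Int_absorb2)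
  qed
  have "g ` piece p \<in> sets (dyck_borel m) \<and>
      emeasure (mu_tilde m) (piece p) = emeasure (mu_tilde m) (g ` piece p)" for p
  proof -
    obtain n u v where p: "p = (n, u, v)" by (cases p)
    let ?J = "{- int n..int n}"
    have g_eq: "g x = override_on x (block n v) ?J" if "x \<in> piece p" for x
    proof
      fix k
      show "g x k = override_on x (block n v) ?J k"
        using that block[of k n "g x"]
        by (cases "k \<in> ?J") (auto simp: p piece_def agree_def override_on_def)
    qed
    then have img: "g ` piece p = (\<lambda>x. override_on x (block n v) ?J) ` piece p"
      by (rule image_cong[OF HOL.refl])
    have u: "x k = block n u k" if "x \<in> piece p" "k \<in> ?J" for x k
      using that block[of k n x] by (auto simp: p piece_def)
    have v: "override_on x (block n v) ?J \<in> dyck_shift m" if "x \<in> piece p" for x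
      using tail[of x] that g_eq[OF that] by (auto simp: double_tail_def p piece_def)
    show ?thesis
      unfolding img using emeasure_mu_tilde_override[where N = n and u = "block n u" and v = "block n v", OF m piece_sets[of p]]
        u v by blast
  qed
  then have img_sets: "g ` piece p \<in> sets (dyck_borel m)"
    and eq: "emeasure (mu_tilde m) (piece p) = emeasure (mu_tilde m) (g ` piece p)" for p
    by blast+
  have sub: "piece p \<subseteq> A" for p by (auto simp: piece_def split: prod.splits)
  have "A \<subseteq> (\<Union>p. piece p)"
  proof
    fix x assume x: "x \<in> A"
    then obtain N where N: "N \<ge> 0" "\<forall>k. \<bar>k\<bar> > N \<longrightarrow> x k = g x k"
      using tail[OF x] by (auto simp: double_tail_def)
    then have "agree (nat N) x" by (simp add: agree_def)
    then obtain n where "agree n x" "\<forall>n'<n. \<not> agree n' x"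
      using exists_least_iff[of "\<lambda>n. agree n x"] by blast
    then have "x \<in> piece (n, map x (window n), map (g x) (window n))"
      using x unfolding piece_def by blast
    then show "x \<in> (\<Union>p. piece p)" by blast
  qed
  with sub have cover: "A = (\<Union>p. piece p)" by blast
  have disj: "disjoint_family piece"
  unfolding disjoint_family_on_def
  proof (intro ballI impI)
    fix p q :: "nat \<times> letter list \<times> letter list"
    assume "p \<noteq> q"
    moreover have "p = q" if "x \<in> piece p" "x \<in> piece q" for x
    proof -
      obtain n u v n' u' v' where pq: "p = (n, u, v)" "q = (n', u', v')" by (cases p; cases q)
      have "n = n'" using that by (auto simp: piece_def pq) (metis linorder_neqE_nat)
      then show ?thesis using that by (auto simp: piece_def pq)
    qed
    ultimately show "piece p \<inter> piece q = {}" by blast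
  qed
  \<comment> \<open>Injectivity of \<open>g\<close> is used here: on a single piece it is automatic,
    but the images of different pieces could otherwise overlap.\<close>
  have disj': "disjoint_family (\<lambda>p. g ` piece p)"
  unfolding disjoint_family_on_def
  proof (intro ballI impI)
    fix p q :: "nat \<times> letter list \<times> letter list"
    assume "p \<noteq> q"
    then have "piece p \<inter> piece q = {}" using disj unfolding disjoint_family_on_def by (metis UNIV_I)
    then show "g ` piece p \<inter> g ` piece q = {}"
      using inj_on_image_Int[OF inj sub sub, of p q] by simp
  qed
  have "emeasure (mu_tilde m) A = (\<integral>\<^sup>+p. emeasure (mu_tilde m) (piece p) \<partial>count_space UNIV)"
    unfolding cover by (rule emeasure_UN_countable) (use piece_sets disj in \<open>auto simp: sets_mu_tilde\<close>)
  also have "\<dots> = (\<integral>\<^sup>+p. emeasure (mu_tilde m) (g ` piece p) \<partial>count_space UNIV)"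
    by (simp only: eq)
  also have "\<dots> = emeasure (mu_tilde m) (\<Union>p. g ` piece p)"
    by (rule emeasure_UN_countable[symmetric]) (use img_sets disj' in \<open>auto simp: sets_mu_tilde\<close>)
  also have "(\<Union>p. g ` piece p) = g ` A" unfolding cover by (rule image_UN[symmetric])
  finally show "emeasure (mu_tilde m) A = emeasure (mu_tilde m) (g ` A)" .
qed

theorem theorem3p1:
  fixes m :: nat
  assumes "m \<ge> 2"
  shows "borel_probability m (mu_tilde m) \<and> double_tail_invariant m (mu_tilde m)"
  using assms prob_space_mu_tilde double_tail_invariant_mu_tilde
  by (simp add: borel_probability_def sets_mu_tilde)

end
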